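(* Let $d\ge 2$ and let $\theta_1,\dots,\theta_d$ be real numbers, all greater than $2$. Then the sequence $(n^{\theta_1},\dots,n^{\theta_d})_{n\ge1}$ has $\infty$-MPPC.
   Context: $\infty$-PPC (Poissonian pair correlation with respect to the sup-norm): for a sequence $(\boldsymbol{y}_n)$ in $[0,1)^d$, $s>0$ and $N\in\mathbb{N}$ let $$R^{(d)}_{2,\infty}(s,(\boldsymbol{y}_n),N):=\frac1N\#\Big\{1\le n\ne m\le N:\ \min_{\boldsymbol{k}\in\mathbb{Z}^d}\|\boldsymbol{y}_n-\boldsymbol{y}_m+\boldsymbol{k}\|_\infty\le \frac{s}{N^{1/d}}\Big\},$$ where ordered pairs $(n,m)$ are counted. The sequence $(\boldsymbol{y}_n)$ has $\infty$-PPC if for every $s>0$, $R^{(d)}_{2,\infty}(s,(\boldsymbol{y}_n),N)\to(2s)^d$ as $N\to\infty$. $\infty$-MPPC (metric Poissonian pair correlation): a sequence $(\boldsymbol{x}_n)$, $\boldsymbol{x}_n=(x_n^{(1)},\dots,x_n^{(d)})\in(\mathbb{R}_{>0})^d$, has $\infty$-MPPC if for Lebesgue-almost all $\boldsymbol{\alpha}=(\alpha_1,\dots,\alpha_d)\in\mathbb{R}^d$ the sequence $\big(\{x_n^{(1)}\alpha_1\},\dots,\{x_n^{(d)}\alpha_d\}\big)_{n\ge1}$ has $\infty$-PPC, where $\{\cdot\}$ denotes the fractional part. *)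

theory Defs
  imports "HOL-Analysis.Analysis"
begin

text \<open>
  Points of $\mathbb{R}^d$ are vectors of type \<^typ>\<open>real ^ 'd\<close>, so that $d$ is \<open>CARD('d)\<close>;
  \<^const>\<open>infnorm\<close> is the sup-norm. Sequences are indexed from 1: their value at 0 is never used.
\<close>

definition integer_points :: "(real ^ 'd) set" where
  "integer_points = {k. \<forall>i. k $ i \<in> \<int>}"

definition infnorm_mod1 :: "real ^ 'd \<Rightarrow> real" where
  "infnorm_mod1 z = (INF k\<in>integer_points. infnorm (z + k))"

text \<open>The infimum is attained, so \<^const>\<open>infnorm_mod1\<close> is the minimum over the integer points.\<close>

lemma infnorm_vec_le_iff:
  fixes z :: "real ^ 'd"
  shows "infnorm z \<le> c \<longleftrightarrow> (\<forall>i. \<bar>z $ i\<bar> \<le> c)"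
  by (auto simp: infnorm_Max Basis_vec_def inner_axis)

lemma infnorm_mod1_attained:
  fixes z :: "real ^ 'd"
  shows "\<exists>k\<in>integer_points. infnorm_mod1 z = infnorm (z + k) \<and>
           (\<forall>l\<in>integer_points. infnorm (z + k) \<le> infnorm (z + l))"
proof -
  define k :: "real ^ 'd" where "k = (\<chi> i. - of_int (round (z $ i)))"
  have k: "k \<in> integer_points"
    by (simp add: k_def integer_points_def)
  have min: "infnorm (z + k) \<le> infnorm (z + l)" if l: "l \<in> integer_points" for l
    unfolding infnorm_vec_le_iff
  proof
    fix i
    obtain m :: int where m: "l $ i = of_int m"
      using l by (auto simp: integer_points_def elim: Ints_cases)
    have "\<bar>(z + k) $ i\<bar> \<le> \<bar>(z + l) $ i\<bar>"
      using round_diff_minimal[of "z $ i" "- m"] by (simp add: k_def m)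
    also have "\<dots> \<le> infnorm (z + l)"
      using infnorm_vec_le_iff[of "z + l" "infnorm (z + l)"] by blast
    finally show "\<bar>(z + k) $ i\<bar> \<le> infnorm (z + l)" .
  qed
  have "infnorm_mod1 z = infnorm (z + k)"
    unfolding infnorm_mod1_def
    by (rule cInf_eq_minimum) (use k min in auto)
  with k min show ?thesis by blast
qed

definition pair_correlation :: "real \<Rightarrow> (nat \<Rightarrow> real ^ 'd) \<Rightarrow> nat \<Rightarrow> real" where
  "pair_correlation s y N =
     real (card {(n, m). n \<in> {1..N} \<and> m \<in> {1..N} \<and> n \<noteq> m \<and>
                   infnorm_mod1 (y n - y m) \<le> s / real N powr (1 / real CARD('d))}) / real N"

definition has_PPC :: "(nat \<Rightarrow> real ^ 'd) \<Rightarrow> bool" where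
  "has_PPC y \<longleftrightarrow>
     (\<forall>s>0. (\<lambda>N. pair_correlation s y N) \<longlonglongrightarrow> (2 * s) ^ CARD('d))"

definition has_MPPC :: "(nat \<Rightarrow> real ^ 'd) \<Rightarrow> bool" where
  "has_MPPC x \<longleftrightarrow>
     (AE \<alpha> in lebesgue. has_PPC (\<lambda>n. \<chi> i. frac (x n $ i * \<alpha> $ i)))"

end

theory Submission
  imports Defs "HOL-Real_Asymp.Real_Asymp" "HOL-Probability.Probability_Measure"
begin

text \<open>
  The number of close pairs is controlled by its second moment over unit cubes of
  \<open>\<alpha>\<close>. Write \<open>D = n\<^sup>\<theta> - m\<^sup>\<theta>\<close> for the gap of a pair, taken in one
  coordinate, and let \<open>\<delta> = s / N\<^bsup>1/d\<^esup>\<close>. By Dirichlet's theorem the events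
  \<open>\<parallel>\<alpha> D\<parallel> \<le> \<delta>\<close> and \<open>\<parallel>\<alpha> D'\<parallel> \<le> \<delta>\<close> are nearly independent unless
  \<open>\<bar>k D' - h D\<bar> \<le> T\<close> for some small integers \<open>h \<le> k\<close>, with \<open>T\<close> a small power of \<open>N\<close>;
  such a resonance costs a factor \<open>1 / (k \<delta>)\<close>. As \<open>d \<ge> 2\<close>, the coordinate with
  the smallest \<open>k\<close> pays \<open>k\<^sup>-\<^sup>2\<close>, so that summing over \<open>h \<le> k\<close> loses only a logarithm, and it
  suffices to save a power of \<open>N\<close> over the trivial bound \<open>N\<^sup>3\<close> for the number of resonant
  quadruples. Cauchy--Schwarz reduces this to \<open>h = k = 1\<close>, i.e. to the additive energy of
  \<open>n\<^sup>\<theta>\<close>, which is bounded by an elementary convexity argument for \<open>\<theta> > 2\<close>. The variance then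
  decays like a power of \<open>N\<close>, which gives almost sure convergence along \<open>N = k\<^sup>q\<close>, and
  monotonicity of the pair count fills the gaps.
\<close>

section \<open>Additive energy\<close>

text \<open>The gaps are not integers, so \<alpha> cannot be placed on a torus where the events have
  exact measures. On a unit cube a single event has a relative boundary error 1 / D, and a pair of
  events one of order T / (\<delta> D). Both are harmless once D \<ge> N^(1 + \<kappa>), and this
  holds whenever the larger index of the pair exceeds N^(1 - \<kappa>). The other pairs number at
  most N^(2 - 2 \<kappa>); for them a first moment is enough. The same \<kappa> is the saving in the
  energy, N^(3 - \<kappa>). Transversality costs a factor N^2 (N / L)^(p - 1) T against L^p with L =
  N^(1 - \<kappa>), which is affordable for p > 2 and \<kappa> small. Since resonances lose a factor
  T in each of the d coordinates besides the logarithm, T must be a power of N small compared with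
  N^\<kappa>, and its exponent has to shrink with d.\<close>

lemma powr_diff_ge:
  fixes m n p :: real
  assumes "1 \<le> p" "0 \<le> m" "m + 1 \<le> n"
  shows "n powr (p - 1) \<le> n powr p - m powr p"
proof -
  have n: "n powr p = n * n powr (p - 1)"
    using assms by (simp add: powr_diff)
  have m: "m powr p = m * m powr (p - 1)"
    using assms by (cases "m = 0") (simp_all add: powr_diff)
  have "m * m powr (p - 1) \<le> m * n powr (p - 1)"
    using assms by (intro mult_left_mono powr_mono2) auto
  also have "\<dots> \<le> (n - 1) * n powr (p - 1)"
    using assms by (intro mult_right_mono) auto
  finally show ?thesis
    unfolding n m by (simp add: algebra_simps)
qed

text \<open>Dilation by r = x2 / x1 maps [x1, x1 + c / r] onto [x2, x2 + c]. By convexity the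
  increment over this initial part of [x1, x1 + c] is at most the share 1 / r of the whole, and
  homogeneity contributes r^p.\<close>

lemma powr_increment_upper:
  fixes x1 x2 c p :: real
  assumes p: "1 \<le> p" and x: "0 < x1" "x1 \<le> x2" and c: "0 \<le> c"
  shows "(x2 + c) powr p - x2 powr p \<le> (x2 / x1) powr (p - 1) * ((x1 + c) powr p - x1 powr p)"
proof -
  define r where "r = x2 / x1"
  have r: "1 \<le> r" "x2 = r * x1"
    using x by (auto simp: r_def)
  have "(x1 + c / r) powr p \<le> (1 - 1 / r) * x1 powr p + 1 / r * (x1 + c) powr p"
  proof -
    have "(1 - 1 / r) *\<^sub>R x1 + (1 / r) *\<^sub>R (x1 + c) = x1 + c / r"
      using r by (simp add: field_simps)
    moreover have "((1 - 1 / r) *\<^sub>R x1 + (1 / r) *\<^sub>R (x1 + c)) powr p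
      \<le> (1 - 1 / r) * x1 powr p + 1 / r * (x1 + c) powr p"
      using convex_onD[OF powr_convex[OF p], of "1 / r" x1 "x1 + c"] x c r by simp
    ultimately show ?thesis by simp
  qed
  then have "(x1 + c / r) powr p - x1 powr p \<le> 1 / r * ((x1 + c) powr p - x1 powr p)"
    by (simp add: algebra_simps)
  then have "r powr p * ((x1 + c / r) powr p - x1 powr p)
      \<le> r powr p * (1 / r * ((x1 + c) powr p - x1 powr p))"
    by (intro mult_left_mono) auto
  also have "\<dots> = r powr (p - 1) * ((x1 + c) powr p - x1 powr p)"
    using r by (simp add: powr_diff)
  also have "r powr p * ((x1 + c / r) powr p - x1 powr p) = (r * (x1 + c / r)) powr p - (r * x1) powr p"
    using r x c by (simp add: powr_mult right_diff_distrib)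
  also have "r * (x1 + c / r) = x2 + c"
    using r by (simp add: algebra_simps)
  finally show ?thesis
    unfolding r(2)[symmetric] unfolding r_def .
qed

text \<open>Here the dilation matches right endpoints: [y1 + a - a / r, y1 + a] goes to
  [y2, y2 + a], and by convexity the final part of an increment receives at least its share 1 /
  r.\<close>

lemma powr_increment_lower:
  fixes y1 y2 a p :: real
  assumes p: "1 \<le> p" and y: "0 < y1" "y1 \<le> y2" and a: "0 \<le> a"
  shows "((y2 + a) / (y1 + a)) powr (p - 1) * ((y1 + a) powr p - y1 powr p)
    \<le> (y2 + a) powr p - y2 powr p"
proof -
  define r where "r = (y2 + a) / (y1 + a)"
  have r: "1 \<le> r" "y2 + a = r * (y1 + a)"
    using y a by (auto simp: r_def)
  have pos: "y1 + a - a / r > 0"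
  proof -
    have "a / r \<le> a"
      using r a mult_left_mono[of 1 r a] by (simp add: divide_le_eq)
    with y show ?thesis by simp
  qed
  have "(y1 + a - a / r) powr p \<le> (1 - 1 / r) * (y1 + a) powr p + 1 / r * y1 powr p"
  proof -
    have "(1 - 1 / r) *\<^sub>R (y1 + a) + (1 / r) *\<^sub>R y1 = y1 + a - a / r"
      using r by (simp add: field_simps)
    moreover have "((1 - 1 / r) *\<^sub>R (y1 + a) + (1 / r) *\<^sub>R y1) powr p
      \<le> (1 - 1 / r) * (y1 + a) powr p + 1 / r * y1 powr p"
      using convex_onD[OF powr_convex[OF p], of "1 / r" "y1 + a" y1] y a r by simp
    ultimately show ?thesis by simp
  qed
  then have "1 / r * ((y1 + a) powr p - y1 powr p) \<le> (y1 + a) powr p - (y1 + a - a / r) powr p"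
    by (simp add: algebra_simps)
  then have "r powr p * (1 / r * ((y1 + a) powr p - y1 powr p))
      \<le> r powr p * ((y1 + a) powr p - (y1 + a - a / r) powr p)"
    by (intro mult_left_mono) auto
  also have "r powr p * (1 / r * ((y1 + a) powr p - y1 powr p))
      = r powr (p - 1) * ((y1 + a) powr p - y1 powr p)"
    using r by (simp add: powr_diff)
  also have "r powr p * ((y1 + a) powr p - (y1 + a - a / r) powr p)
      = (r * (y1 + a)) powr p - (r * (y1 + a - a / r)) powr p"
    using r(1) y a powr_mult[of r "y1 + a - a / r" p] powr_mult[of r "y1 + a" p] pos
    by (simp only: right_diff_distrib)
  also have "r * (y1 + a - a / r) = y2"
    using r by (simp add: algebra_simps)
  finally show ?thesis
    unfolding r(2)[symmetric] unfolding r_def .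
qed

lemma powr_increment_mono:
  fixes x y v p :: real
  assumes "1 \<le> p" "0 < y" "y \<le> x" "0 \<le> v"
  shows "(y + v) powr p - y powr p \<le> (x + v) powr p - x powr p"
proof -
  have "1 \<le> ((x + v) / (y + v)) powr (p - 1)"
    using assms by (intro ge_one_powr_ge_zero) auto
  moreover have "0 \<le> (y + v) powr p - y powr p"
    using assms by (simp add: powr_mono2)
  ultimately have "(y + v) powr p - y powr p
      \<le> ((x + v) / (y + v)) powr (p - 1) * ((y + v) powr p - y powr p)"
    using mult_right_mono[of 1 "((x + v) / (y + v)) powr (p - 1)" "(y + v) powr p - y powr p"] by simp
  also have "\<dots> \<le> (x + v) powr p - x powr p"
    using assms by (intro powr_increment_lower)
  finally show ?thesis .
qed

text \<open>Along \<open>x\<^sup>p - y\<^sup>p = C\<close> the difference \<open>x - y\<close> decreases in \<open>y\<close>, while along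
  \<open>(x + c)\<^sup>p - x\<^sup>p = (y + a)\<^sup>p - y\<^sup>p\<close> the quotient \<open>x / y\<close> is nearly constant, so that
  \<open>x - y\<close> increases. The two curves are therefore transversal.\<close>

lemma transversal_curves:
  fixes x y u v a c p L T N :: real
  assumes p: "2 \<le> p" and L: "0 < L" "L \<le> y" and xy: "y + a + L / 2 \<le> x"
    and uv: "0 \<le> u" "u \<le> v" "1 \<le> v" and a: "1 \<le> a" and c: "0 \<le> c"
    and N: "x + u \<le> N" and T: "0 \<le> T"
    and 1: "\<bar>((x + c) powr p - x powr p) - ((y + a) powr p - y powr p)\<bar> \<le> 2 * T"
    and 2: "\<bar>((x + u + c) powr p - (x + u) powr p) - ((y + v + a) powr p - (y + v) powr p)\<bar> \<le> 2 * T"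
  shows "L powr p \<le> 8 * T * N\<^sup>2 * (N / L) powr (p - 1)"
proof -
  define X where "X = (y + a) powr p - y powr p"
  \<comment> \<open>Approximate equality of the increments at both places forces q^(p - 1) and r^(p
    - 1) to nearly agree. \<open>r\<close> compares left endpoints and \<open>q\<close> right
    endpoints, as the upper and the lower convexity bound demand.\<close>
  define r where "r = (x + u) / x"
  define q where "q = (y + v + a) / (y + a)"
  have pos: "0 < y" "0 < x" "0 < N"
    using L xy a uv N by auto
  have NL: "L \<le> N"
    using L xy a uv N by linarith
  have r1: "1 \<le> r" "r = 1 + u / x"
    using pos uv by (auto simp: r_def field_simps)
  have q1: "q = 1 + v / (y + a)"
    using pos uv a by (auto simp: q_def field_simps)
  have rN: "r \<le> N / L"
    unfolding r_def using pos L xy a uv N by (intro frac_le) auto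
  \<comment> \<open>As u \<le> v and 1 \<le> v, the difference is at least 1 / (y + a) - 1 / x,
    which stays away from 0 because y + a and x are L / 2 apart.\<close>
  have qr: "L / (2 * N\<^sup>2) \<le> q - r"
  proof -
    have "(y + a) * x \<le> N * N"
      using L xy a uv N pos by (intro mult_mono) auto
    then have "(L / 2) / (N * N) \<le> (x - (y + a)) / ((y + a) * x)"
      using pos a xy L by (intro frac_le) auto
    also have "\<dots> = 1 / (y + a) - 1 / x"
      using pos a by (simp add: field_simps)
    also have "\<dots> \<le> v * (1 / (y + a) - 1 / x)"
    proof -
      have "0 \<le> 1 / (y + a) - 1 / x"
        using pos a xy L by (simp add: field_simps)
      then show ?thesis
        using mult_right_mono[OF uv(3), of "1 / (y + a) - 1 / x"] by simp
    qed
    also have "\<dots> \<le> v / (y + a) - u / x"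
      using divide_right_mono[OF uv(2), of x] pos by (simp add: right_diff_distrib)
    finally show ?thesis
      by (simp add: r1 q1 power2_eq_square)
  qed
  \<comment> \<open>The function z^(p - 1) - z = z (z^(p - 2) - 1) is increasing on z \<ge> 1 when p
    \<ge> 2.\<close>
  have pow: "q - r \<le> q powr (p - 1) - r powr (p - 1)"
  proof -
    have "0 \<le> L / (2 * N\<^sup>2)"
      using L by simp
    with qr have qr': "r \<le> q"
      by linarith
    have "r * (r powr (p - 2) - 1) \<le> q * (q powr (p - 2) - 1)"
      using r1 qr' p by (intro mult_mono diff_right_mono powr_mono2) (auto intro: ge_one_powr_ge_zero)
    moreover have "z powr (p - 1) = z * z powr (p - 2)" if "z > 0" for z
      using powr_add[of z 1 "p - 2"] that by simp
    ultimately show ?thesis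
      using r1 qr' by (simp add: algebra_simps)
  qed
  have XL: "L powr (p - 1) \<le> X"
  proof -
    have "L powr (p - 1) \<le> (y + a) powr (p - 1)"
      using L a p by (intro powr_mono2) auto
    also have "\<dots> \<le> X"
      unfolding X_def using p pos a by (intro powr_diff_ge) auto
    finally show ?thesis .
  qed
  have "q powr (p - 1) * X \<le> (y + v + a) powr p - (y + v) powr p"
    unfolding X_def q_def using p pos a uv by (intro powr_increment_lower) auto
  also have "\<dots> \<le> ((x + u + c) powr p - (x + u) powr p) + 2 * T"
    using 2 by linarith
  also have "\<dots> \<le> r powr (p - 1) * ((x + c) powr p - x powr p) + 2 * T"
    unfolding r_def using p pos c uv by (intro add_right_mono powr_increment_upper) auto
  also have "\<dots> \<le> r powr (p - 1) * (X + 2 * T) + 2 * T"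
    using 1 unfolding X_def by (intro add_right_mono mult_left_mono) auto
  finally have "(q powr (p - 1) - r powr (p - 1)) * X \<le> 2 * T * r powr (p - 1) + 2 * T"
    by (simp add: algebra_simps)
  also have "\<dots> \<le> 2 * T * (N / L) powr (p - 1) + 2 * T * (N / L) powr (p - 1)"
  proof -
    have "1 \<le> (N / L) powr (p - 1)"
      using NL L p by (intro ge_one_powr_ge_zero) auto
    moreover have "r powr (p - 1) \<le> (N / L) powr (p - 1)"
      using r1 rN p by (intro powr_mono2) auto
    moreover have "2 * T * 1 \<le> 2 * T * (N / L) powr (p - 1)"
      using T calculation by (intro mult_left_mono) auto
    moreover have "2 * T * r powr (p - 1) \<le> 2 * T * (N / L) powr (p - 1)"
      using T calculation by (intro mult_left_mono) auto
    ultimately show ?thesis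
      by linarith
  qed
  finally have *: "(q powr (p - 1) - r powr (p - 1)) * X \<le> 4 * T * (N / L) powr (p - 1)"
    by simp
  have "L / (2 * N\<^sup>2) * L powr (p - 1) \<le> (q powr (p - 1) - r powr (p - 1)) * X"
  proof (intro mult_mono)
    show "L / (2 * N\<^sup>2) \<le> q powr (p - 1) - r powr (p - 1)"
      using qr pow by linarith
    moreover have "0 \<le> L / (2 * N\<^sup>2)"
      using L by simp
    ultimately show "0 \<le> q powr (p - 1) - r powr (p - 1)"
      by linarith
  qed (use XL in auto)
  with * have "L / (2 * N\<^sup>2) * L powr (p - 1) \<le> 4 * T * (N / L) powr (p - 1)"
    by linarith
  moreover have "L powr p = L * L powr (p - 1)"
    using L powr_add[of L 1 "p - 1"] by simp
  ultimately have "L powr p / (2 * N\<^sup>2) \<le> 4 * T * (N / L) powr (p - 1)"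
    by simp
  then show ?thesis
    using pos by (simp add: pos_divide_le_eq mult_ac)
qed

section \<open>Near-solutions of x^p - y^p = C\<close>

text \<open>Cut {..N} into blocks of length A. Blocks with at most one point contribute at most N
  div A + 1. In every other block choose two points y < y'. The pattern (y' - y, X y' - X y) lies in
  {1..A} \<times> {1..A}, since X grows no faster than its argument, and by \<open>pat\<close> no
  two blocks share a pattern. So there are at most A^2 such blocks, with at most A points
  each.\<close>

lemma card_le_of_distinct_patterns:
  fixes Y :: "nat set" and X :: "nat \<Rightarrow> nat" and A N :: nat
  assumes Y: "Y \<subseteq> {..N}" and A: "1 \<le> A"
    and X: "\<And>y y'. y \<in> Y \<Longrightarrow> y' \<in> Y \<Longrightarrow> y < y' \<Longrightarrow> X y < X y' \<and> X y' - X y \<le> y' - y"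
    and pat: "\<And>y z a c. y \<in> Y \<Longrightarrow> z \<in> Y \<Longrightarrow> y + a \<in> Y \<Longrightarrow> z + a \<in> Y \<Longrightarrow> 1 \<le> a \<Longrightarrow> a \<le> A \<Longrightarrow>
      y < z \<Longrightarrow> X (y + a) = X y + c \<Longrightarrow> X (z + a) = X z + c \<Longrightarrow> False"
  shows "card Y \<le> N div A + 1 + A ^ 3"
proof -
  define B where "B k = {y \<in> Y. y div A = k}" for k
  define K where "K = {k \<in> {..N div A}. 2 \<le> card (B k)}"
  have fin: "finite Y"
    using Y finite_subset by blast
  then have finB: "finite (B k)" for k
    by (simp add: B_def)
  have subB: "B k \<subseteq> {k * A..<k * A + A}" for k
  proof
    fix y assume "y \<in> B k"
    then have "y = k * A + y mod A"
      by (auto simp: B_def)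
    moreover have "y mod A < A"
      using A by simp
    ultimately show "y \<in> {k * A..<k * A + A}"
      by (metis add_less_cancel_left atLeastLessThan_iff le_add1)
  qed
  have cardB: "card (B k) \<le> A" for k
    using card_mono[OF _ subB[of k]] by simp
  have "\<exists>y y'. y \<in> B k \<and> y' \<in> B k \<and> y < y'" if "k \<in> K" for k
  proof -
    have "\<not> card (B k) \<le> Suc 0"
      using that by (auto simp: K_def)
    then obtain y y' where "y \<in> B k" "y' \<in> B k" "y \<noteq> y'"
      using card_le_Suc0_iff_eq[OF finB] by blast
    then show ?thesis
      by (meson linorder_neqE_nat)
  qed
  then obtain f g where fg: "\<And>k. k \<in> K \<Longrightarrow> f k \<in> B k" "\<And>k. k \<in> K \<Longrightarrow> g k \<in> B k"
      "\<And>k. k \<in> K \<Longrightarrow> f k < g k"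
    by metis
  define h where "h k = (g k - f k, X (g k) - X (f k))" for k
  have diff: "g k - f k \<le> A" if "k \<in> K" for k
  proof -
    have "g k < k * A + A" "k * A \<le> f k"
      using fg[OF that] subB[of k] by auto
    then show ?thesis by linarith
  qed
  have "inj_on h K"
  proof (rule inj_onI, rule ccontr)
    fix k l assume kl: "k \<in> K" "l \<in> K" "h k = h l" "k \<noteq> l"
    have sym: False if "k \<in> K" "l \<in> K" "h k = h l" "f k < f l" for k l
    proof -
      have Y4: "f k \<in> Y" "f l \<in> Y" "g k \<in> Y" "g l \<in> Y"
        using fg that by (auto simp: B_def)
      have gk: "g k = f k + (g k - f k)" and gl: "g l = f l + (g k - f k)"
        using that fg(3)[of k] fg(3)[of l] by (auto simp: h_def)
      have Xk: "X (g k) = X (f k) + (X (g k) - X (f k))"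
        and Xl: "X (g l) = X (f l) + (X (g k) - X (f k))"
        using that fg(3)[of k] fg(3)[of l] X[of "f k" "g k"] X[of "f l" "g l"] Y4
        by (auto simp: h_def)
      show False
        using pat[of "f k" "f l" "g k - f k" "X (g k) - X (f k)"] Y4 gk gl Xk Xl diff[OF that(1)]
          fg(3)[OF that(1)] that(4) by simp
    qed
    have "f k \<noteq> f l"
      using fg(1)[OF kl(1)] fg(1)[OF kl(2)] kl(4) by (auto simp: B_def)
    then show False
      using sym kl by (metis linorder_neqE_nat)
  qed
  moreover have "h ` K \<subseteq> {1..A} \<times> {1..A}"
  proof
    fix w assume "w \<in> h ` K"
    then obtain k where k: "k \<in> K" "w = h k" by blast
    then have "X (f k) < X (g k)" "X (g k) - X (f k) \<le> g k - f k"
      using X[of "f k" "g k"] fg[OF k(1)] by (auto simp: B_def)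
    then show "w \<in> {1..A} \<times> {1..A}"
      using k diff[OF k(1)] fg(3)[OF k(1)] by (auto simp: h_def)
  qed
  ultimately have cardK: "card K \<le> A * A"
    using card_inj_on_le[of h K "{1..A} \<times> {1..A}"] by (simp add: card_cartesian_product)
  have "Y = (\<Union>k\<in>{..N div A}. B k)"
    using Y by (auto simp: B_def div_le_mono)
  then have "card Y = card (\<Union>k\<in>{..N div A}. B k)"
    by simp
  also have "\<dots> = (\<Sum>k\<le>N div A. card (B k))"
    by (rule card_UN_disjoint) (use finB in \<open>auto simp: B_def\<close>)
  also have "\<dots> \<le> (\<Sum>k\<le>N div A. 1 + (if k \<in> K then A else 0))"
  proof (intro sum_mono)
    fix k assume "k \<in> {..N div A}"
    then show "card (B k) \<le> 1 + (if k \<in> K then A else 0)"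
      using cardB[of k] by (auto simp: K_def)
  qed
  also have "\<dots> = (N div A + 1) + card K * A"
  proof -
    have "{..N div A} \<inter> K = K"
      by (auto simp: K_def)
    then show ?thesis
      by (subst sum.distrib) (simp add: sum.If_cases)
  qed
  also have "\<dots> \<le> (N div A + 1) + A * A * A"
    using cardK by (intro add_left_mono mult_right_mono) auto
  finally show ?thesis
    by (simp add: power3_eq_cube)
qed

text \<open>By \<open>gap\<close>, distinct powers differ by more than 2 T, so y determines x along
  the thickened curve. As x > y and increments of t^p grow with t, x increases with y but never by
  more than y does. A difference pattern (a, c) occurring at two values of y is the configuration
  that \<open>transversal_curves\<close> and \<open>big\<close> exclude. The conditions L \<le> y
  and y + L \<le> x keep away from the axis and the diagonal, where the transversality estimate
  degenerates.\<close>

lemma card_powr_diff_near_le: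
  fixes p L T C :: real and A N :: nat and G :: "(nat \<times> nat) set"
  assumes p: "2 \<le> p" and L: "0 < L" and A: "1 \<le> A" "2 * real A \<le> L" and T: "0 \<le> T"
    and gap: "2 * T < L powr (p - 1)"
    and big: "8 * T * (real N)\<^sup>2 * (real N / L) powr (p - 1) < L powr p"
    and G: "\<And>x y. (x, y) \<in> G \<Longrightarrow> L \<le> real y \<and> real y + L \<le> real x \<and> x \<le> N \<and>
      \<bar>real x powr p - real y powr p - C\<bar> \<le> T"
  shows "card G \<le> N div A + 1 + A ^ 3"
proof -
  have step: "2 * T < real n powr p - real m powr p" if "m < n" "L \<le> real n" for m n :: nat
  proof -
    have "L powr (p - 1) \<le> real n powr (p - 1)"
      using that L p by (intro powr_mono2) auto
    also have "\<dots> \<le> real n powr p - real m powr p"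
      using that p by (intro powr_diff_ge) auto
    finally show ?thesis using gap by linarith
  qed
  have mono: "x < x' \<and> x' - x \<le> y' - y"
    if g: "(x, y) \<in> G" "(x', y') \<in> G" and "y < y'" for x y x' y'
  proof -
    have near: "\<bar>(real x' powr p - real x powr p) - (real y' powr p - real y powr p)\<bar> \<le> 2 * T"
      using G[OF g(1)] G[OF g(2)] by linarith
    have "2 * T < real y' powr p - real y powr p"
      using G[OF g(2)] \<open>y < y'\<close> by (intro step) auto
    with near have "0 < real x' powr p - real x powr p"
      by linarith
    then have x: "x < x'"
      using p by (smt (verit) not_less of_nat_0_le_iff of_nat_le_iff powr_mono2)
    moreover have "x' - x \<le> y' - y"
    proof (rule ccontr)
      assume "\<not> x' - x \<le> y' - y"
      then have "x + (y' - y) < x'"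
        using x by linarith
      moreover have "L \<le> real x'"
        using G[OF g(2)] by linarith
      ultimately have "2 * T < real x' powr p - real (x + (y' - y)) powr p"
        by (intro step)
      moreover have "(real y + real (y' - y)) powr p - real y powr p
          \<le> (real x + real (y' - y)) powr p - real x powr p"
        using p L G[OF g(1)] by (intro powr_increment_mono) auto
      moreover have "real y + real (y' - y) = real y'"
        using \<open>y < y'\<close> by simp
      ultimately show False
        using near by (simp add: of_nat_add add_diff_eq)
    qed
    ultimately show ?thesis ..
  qed
  have uniq: "x = x'" if g: "(x, y) \<in> G" "(x', y) \<in> G" for x x' y
  proof (rule ccontr)
    assume "x \<noteq> x'"
    have near: "\<bar>real x' powr p - real x powr p\<bar> \<le> 2 * T"
      using G[OF g(1)] G[OF g(2)] by linarith
    have "L \<le> real x" "L \<le> real x'"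
      using G[OF g(1)] G[OF g(2)] by linarith+
    then show False
      using near \<open>x \<noteq> x'\<close> step[of x x'] step[of x' x] by (cases "x < x'") auto
  qed
  define X where "X y = (THE x. (x, y) \<in> G)" for y
  have X: "X y = x" if "(x, y) \<in> G" for x y
    unfolding X_def using that uniq by blast
  then have XG: "(X y, y) \<in> G" if "y \<in> snd ` G" for y
    using that by force
  have "card G = card (snd ` G)"
    using uniq by (intro card_image[symmetric]) (auto simp: inj_on_def)
  also have "\<dots> \<le> N div A + 1 + A ^ 3"
  proof (rule card_le_of_distinct_patterns[where X = X])
    show "snd ` G \<subseteq> {..N}"
      using G L by force
    show "X y < X y' \<and> X y' - X y \<le> y' - y" if "y \<in> snd ` G" "y' \<in> snd ` G" "y < y'" for y y'
      using mono[OF XG XG] that by blast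
  next
    fix y z a c
    assume y: "y \<in> snd ` G" "z \<in> snd ` G" "y + a \<in> snd ` G" "z + a \<in> snd ` G"
      and a: "1 \<le> a" "a \<le> A" and "y < z" and c: "X (y + a) = X y + c" "X (z + a) = X z + c"
    \<comment> \<open>(v, u) is the displacement between the two occurrences of the pattern (a, c).
      Below, 2 A \<le> L turns the distance L from the diagonal into y + a + L / 2 \<le> x.\<close>
    define u where "u = X z - X y"
    define v where "v = z - y"
    have uv: "X y < X z" "u \<le> v"
      using mono[OF XG XG] y \<open>y < z\<close> by (auto simp: u_def v_def)
    have Gy: "L \<le> real y" "real y + L \<le> real (X y)" "\<bar>real (X y) powr p - real y powr p - C\<bar> \<le> T"
      and Gz: "X z \<le> N" "\<bar>real (X z) powr p - real z powr p - C\<bar> \<le> T"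
      and Gya: "\<bar>real (X y + c) powr p - real (y + a) powr p - C\<bar> \<le> T"
      and Gza: "\<bar>real (X z + c) powr p - real (z + a) powr p - C\<bar> \<le> T"
      using G[OF XG[OF y(1)]] G[OF XG[OF y(2)]] G[OF XG[OF y(3)]] G[OF XG[OF y(4)]]
      by (auto simp: c)
    have z: "real z = real y + real v" "real (X z) = real (X y) + real u"
      using \<open>y < z\<close> uv by (auto simp: v_def u_def)
    have "L powr p \<le> 8 * T * (real N)\<^sup>2 * (real N / L) powr (p - 1)"
    proof (rule transversal_curves[where y = "real y" and x = "real (X y)" and u = "real u" and v = "real v"
          and a = "real a" and c = "real c"])
      show "real y + real a + L / 2 \<le> real (X y)"
        using Gy A a by linarith
      show "\<bar>(real (X y) + real c) powr p - real (X y) powr p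
          - ((real y + real a) powr p - real y powr p)\<bar> \<le> 2 * T"
        using Gy Gya by simp
      show "\<bar>(real (X y) + real u + real c) powr p - (real (X y) + real u) powr p
          - ((real y + real v + real a) powr p - (real y + real v) powr p)\<bar> \<le> 2 * T"
        using Gz Gza unfolding z[symmetric] by simp
      show "real (X y) + real u \<le> real N"
        using z Gz by simp
      show "1 \<le> real v"
        using \<open>y < z\<close> by (simp add: v_def)
    qed (use p L Gy uv a T in auto)
    then show False
      using big by linarith
  qed (use A in auto)
  finally show ?thesis .
qed

section \<open>Near-coincidences between gaps\<close>

text \<open>Only the larger index is bounded below. This already forces gaps of size L^(p - 1), and
  the pairs left out fit into a square of side L.\<close>

definition large_pairs :: "real \<Rightarrow> nat \<Rightarrow> (nat \<times> nat) set" where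
  "large_pairs L N = {(n, m). 1 \<le> m \<and> m < n \<and> n \<le> N \<and> L < real n}"

definition powr_gap :: "real \<Rightarrow> nat \<times> nat \<Rightarrow> real" where
  "powr_gap p w = real (fst w) powr p - real (snd w) powr p"

lemma large_pairs_subset: "large_pairs L N \<subseteq> {1..N} \<times> {1..N}"
  by (auto simp: large_pairs_def)

lemma finite_large_pairs [simp]: "finite (large_pairs L N)"
  by (rule finite_subset[OF large_pairs_subset]) simp

lemma card_large_pairs_le: "card (large_pairs L N) \<le> N\<^sup>2"
  using card_mono[OF _ large_pairs_subset[of L N]]
  by (simp add: card_cartesian_product power2_eq_square)

lemma card_less_real_le:
  fixes L :: real
  assumes "0 \<le> L" "\<And>k. k \<in> S \<Longrightarrow> 1 \<le> k \<and> real k < L"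
  shows "real (card S) \<le> L"
proof -
  have "S \<subseteq> {1..nat \<lfloor>L\<rfloor>}"
    using assms by (force simp: le_nat_iff le_floor_iff)
  then have "card S \<le> nat \<lfloor>L\<rfloor>"
    using card_mono[of "{1..nat \<lfloor>L\<rfloor>}" S] by simp
  then show ?thesis
    using assms(1) by (meson le_nat_floor of_nat_floor of_nat_le_iff order_trans)
qed

text \<open>For fixed w the curve estimate counts the near w' outside \<open>bad\<close>, that is,
  away from the axis and the diagonal. There are at most 2 N L bad w', and each is near at most N
  pairs w. The second count starts from w' rather than from w, hence the swap in the
  covering.\<close>

lemma card_energy_le:
  fixes p L T :: real and A N :: nat
  assumes p: "2 \<le> p" and L: "0 < L" and A: "1 \<le> A" "2 * real A \<le> L" and T: "0 \<le> T"
    and gap: "2 * T < L powr (p - 1)"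
    and big: "8 * T * (real N)\<^sup>2 * (real N / L) powr (p - 1) < L powr p"
  defines "P \<equiv> large_pairs L N"
  shows "real (card {(w, w') \<in> P \<times> P. \<bar>powr_gap p w - powr_gap p w'\<bar> \<le> T})
    \<le> (real N)\<^sup>2 * (real N / real A + 1 + real A ^ 3) + 2 * (real N)\<^sup>2 * L"
proof -
  define near where "near w = {w' \<in> P. \<bar>powr_gap p w - powr_gap p w'\<bar> \<le> T}" for w
  define bad where "bad = {(x, y) \<in> P. real y < L \<or> real x < real y + L}"
  have finP: "finite P"
    by (simp add: P_def)
  have fin: "finite (near w)" for w
    using finP by (simp add: near_def)
  have "finite bad"
    using finP by (auto intro: finite_subset simp: bad_def)
  have good: "card (near w - bad) \<le> N div A + 1 + A ^ 3" for w
    by (rule card_powr_diff_near_le[where C = "powr_gap p w", OF p L A T gap big])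
      (auto simp: near_def bad_def P_def large_pairs_def powr_gap_def)
  \<comment> \<open>The smaller index determines the pair: two larger indices for the same smaller
    one would give gaps at least L^(p - 1) > 2 T apart.\<close>
  have near_card: "card (near w) \<le> N" for w
  proof -
    have "inj_on snd (near w)"
    proof (rule inj_onI, rule ccontr)
      fix u v assume uv: "u \<in> near w" "v \<in> near w" "snd u = snd v" "u \<noteq> v"
      have False if "u \<in> near w" "v \<in> near w" "snd u = snd v" "fst u < fst v" for u v
      proof -
        have "L powr (p - 1) \<le> real (fst v) powr (p - 1)"
          using that L p by (intro powr_mono2) (auto simp: near_def P_def large_pairs_def)
        also have "\<dots> \<le> real (fst v) powr p - real (fst u) powr p"
          using that p by (intro powr_diff_ge) auto
        finally have "2 * T < powr_gap p v - powr_gap p u"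
          using gap that by (simp add: powr_gap_def)
        then show False
          using that by (simp add: near_def) linarith
      qed
      then show False
        using uv by (metis linorder_neqE_nat prod.expand)
    qed
    moreover have "snd ` near w \<subseteq> {1..N}"
      by (auto simp: near_def P_def large_pairs_def)
    ultimately show ?thesis
      using card_inj_on_le[of snd "near w" "{1..N}"] by simp
  qed
  have bad_card: "real (card bad) \<le> 2 * real N * L"
  proof -
    define S where "S = {k. 1 \<le> k \<and> real k < L}"
    have "S \<subseteq> {..nat \<lfloor>L\<rfloor>}"
      by (auto simp: S_def le_nat_iff le_floor_iff)
    then have finS: "finite S"
      using finite_subset by blast
    have S: "real (card S) \<le> L"
      using L by (intro card_less_real_le) (auto simp: S_def)
    \<comment> \<open>The two families are the pairs with y < L, whatever the larger index, and the
      pairs (y + k, y) with 1 \<le> k < L.\<close>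
    have "bad \<subseteq> {1..N} \<times> S \<union> (\<lambda>(y, k). (y + k, y)) ` ({1..N} \<times> S)"
    proof
      fix w assume w: "w \<in> bad"
      obtain x y where xy: "w = (x, y)" by fastforce
      show "w \<in> {1..N} \<times> S \<union> (\<lambda>(y, k). (y + k, y)) ` ({1..N} \<times> S)"
      proof (cases "real y < L")
        case True
        then show ?thesis
          using w xy by (auto simp: bad_def P_def large_pairs_def S_def)
      next
        case False
        then have "w = (\<lambda>(y, k). (y + k, y)) (y, x - y)" "(y, x - y) \<in> {1..N} \<times> S"
          using w xy by (auto simp: bad_def P_def large_pairs_def S_def)
        then show ?thesis by blast
      qed
    qed
    then have "card bad \<le> card ({1..N} \<times> S \<union> (\<lambda>(y, k). (y + k, y)) ` ({1..N} \<times> S))"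
      using finS by (intro card_mono) auto
    also have "\<dots> \<le> card ({1..N} \<times> S) + card ({1..N} \<times> S)"
      using finS by (intro order_trans[OF card_Un_le] add_left_mono card_image_le) auto
    also have "\<dots> = 2 * (N * card S)"
      by (simp add: card_cartesian_product)
    finally have "card bad \<le> 2 * (N * card S)" .
    then have "real (card bad) \<le> real (2 * (N * card S))"
      by (simp only: of_nat_le_iff)
    also have "\<dots> = 2 * real N * real (card S)"
      by simp
    also have "\<dots> \<le> 2 * real N * L"
      using S by (intro mult_left_mono) auto
    finally show ?thesis .
  qed
  let ?E = "{(w, w') \<in> P \<times> P. \<bar>powr_gap p w - powr_gap p w'\<bar> \<le> T}"
  have "?E \<subseteq> (SIGMA w:P. near w - bad) \<union> prod.swap ` (SIGMA w':bad. near w')"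
  proof
    fix e assume e: "e \<in> ?E"
    obtain w w' where ww: "e = (w, w')" by (cases e)
    show "e \<in> (SIGMA w:P. near w - bad) \<union> prod.swap ` (SIGMA w':bad. near w')"
    proof (cases "w' \<in> bad")
      case True
      then have "(w', w) \<in> (SIGMA w':bad. near w')"
        using e ww by (auto simp: near_def abs_minus_commute)
      then show ?thesis
        using ww by force
    next
      case False
      then show ?thesis
        using e ww by (auto simp: near_def)
    qed
  qed
  then have "card ?E \<le> card ((SIGMA w:P. near w - bad) \<union> prod.swap ` (SIGMA w':bad. near w'))"
    using finP fin \<open>finite bad\<close> by (intro card_mono) auto
  also have "\<dots> \<le> card (SIGMA w:P. near w - bad) + card (SIGMA w':bad. near w')"
    using finP fin \<open>finite bad\<close>
    by (intro order_trans[OF card_Un_le] add_left_mono card_image_le) auto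
  also have "\<dots> = (\<Sum>w\<in>P. card (near w - bad)) + (\<Sum>w'\<in>bad. card (near w'))"
    using finP fin \<open>finite bad\<close> by (simp add: card_SigmaI)
  also have "\<dots> \<le> card P * (N div A + 1 + A ^ 3) + card bad * N"
    using good near_card by (intro add_mono sum_bounded_above[where K = "_ :: nat", simplified]) auto
  also have "\<dots> \<le> N\<^sup>2 * (N div A + 1 + A ^ 3) + card bad * N"
    unfolding P_def by (intro add_right_mono mult_right_mono card_large_pairs_le) auto
  finally have "real (card ?E) \<le> real (N\<^sup>2 * (N div A + 1 + A ^ 3) + card bad * N)"
    by (simp only: of_nat_le_iff)
  also have "\<dots> = (real N)\<^sup>2 * (real (N div A) + 1 + real A ^ 3) + real (card bad) * real N"
    by (simp add: algebra_simps)
  also have "\<dots> \<le> (real N)\<^sup>2 * (real N / real A + 1 + real A ^ 3) + 2 * real N * L * real N"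
    using bad_card by (intro add_mono mult_left_mono mult_right_mono order_refl of_nat_div_le_of_nat) auto
  finally show ?thesis
    by (simp add: power2_eq_square mult_ac)
qed

section \<open>Dilated coincidences\<close>

text \<open>Sum 2 a b \<le> a^2 + b^2 over the values j, where a and b are the sizes of the fibres
  of f and g over j.\<close>

lemma card_coincidences_le:
  fixes f g :: "'a \<Rightarrow> int"
  assumes fin: "finite P"
  shows "2 * card {(x, y) \<in> P \<times> P. f x = g y}
    \<le> card {(x, y) \<in> P \<times> P. f x = f y} + card {(x, y) \<in> P \<times> P. g x = g y}"
proof -
  define J where "J = f ` P \<union> g ` P"
  define F where "F h j = {x \<in> P. h x = j}" for h :: "'a \<Rightarrow> int" and j
  have finJ: "finite J" and finF: "finite (F h j)" for h j
    using fin by (auto simp: J_def F_def)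
  have eq: "card {(x, y) \<in> P \<times> P. h x = k y} = (\<Sum>j\<in>J. card (F h j) * card (F k j))"
    if "h ` P \<subseteq> J" for h k
  proof -
    have "{(x, y) \<in> P \<times> P. h x = k y} = (\<Union>j\<in>J. F h j \<times> F k j)"
      using that by (auto simp: F_def)
    then have "card {(x, y) \<in> P \<times> P. h x = k y} = card (\<Union>j\<in>J. F h j \<times> F k j)"
      by simp
    also have "\<dots> = (\<Sum>j\<in>J. card (F h j \<times> F k j))"
      by (rule card_UN_disjoint) (use finJ finF in \<open>auto simp: F_def\<close>)
    finally show ?thesis
      by (simp add: card_cartesian_product)
  qed
  have "2 * card {(x, y) \<in> P \<times> P. f x = g y} = (\<Sum>j\<in>J. 2 * card (F f j) * card (F g j))"
    by (subst eq) (auto simp: J_def sum_distrib_left mult_ac)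
  also have "\<dots> \<le> (\<Sum>j\<in>J. card (F f j) * card (F f j) + card (F g j) * card (F g j))"
  proof (rule sum_mono)
    fix j
    have "2 * a * b \<le> a * a + b * b" for a b :: nat
    proof -
      have "real (2 * a * b) \<le> real (a * a + b * b)"
        using sum_squares_bound[of "real a" "real b"] by (simp add: power2_eq_square)
      then show ?thesis by (simp only: of_nat_le_iff)
    qed
    then show "2 * card (F f j) * card (F g j) \<le> card (F f j) * card (F f j) + card (F g j) * card (F g j)" .
  qed
  also have "\<dots> = card {(x, y) \<in> P \<times> P. f x = f y} + card {(x, y) \<in> P \<times> P. g x = g y}"
    by (subst (1 2) eq) (auto simp: J_def sum.distrib)
  finally show ?thesis .
qed

text \<open>Passing from \<open>\<bar>a D - b D'\<bar> \<le> T\<close> to \<open>\<bar>D - D'\<bar> \<le> T\<close> is Cauchy--Schwarz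
  after sorting the values into bins of length \<open>T\<close>.\<close>

lemma card_dilated_near_le:
  fixes D :: "'a \<Rightarrow> real" and a b T :: real
  assumes fin: "finite P" and T: "0 < T" and ab: "1 \<le> a" "1 \<le> b"
  shows "card {(x, y) \<in> P \<times> P. \<bar>a * D x - b * D y\<bar> \<le> T}
    \<le> 3 * card {(x, y) \<in> P \<times> P. \<bar>D x - D y\<bar> \<le> T}"
proof -
  let ?E = "card {(x, y) \<in> P \<times> P. \<bar>D x - D y\<bar> \<le> T}"
  define f where "f a x = \<lfloor>a * D x / T\<rfloor>" for a x
  \<comment> \<open>Two points in one bin satisfy a |D x - D y| \<le> T, and a \<ge> 1 makes this
    stronger than nearness without dilation.\<close>
  have same: "card {(x, y) \<in> P \<times> P. f a x = f a y} \<le> ?E" if a: "1 \<le> a" for a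
  proof (intro card_mono subsetI)
    fix w assume "w \<in> {(x, y) \<in> P \<times> P. f a x = f a y}"
    then obtain x y where w: "w = (x, y)" "x \<in> P" "y \<in> P" "f a x = f a y" by auto
    have "\<bar>a * D x / T - a * D y / T\<bar> \<le> 1"
      using w(4) unfolding f_def by linarith
    moreover have "\<bar>a * D x / T - a * D y / T\<bar> = a * \<bar>D x - D y\<bar> / T"
      using a T by (simp add: abs_mult diff_divide_distrib[symmetric] right_diff_distrib[symmetric])
    ultimately have "a * \<bar>D x - D y\<bar> \<le> T"
      using T by (simp add: divide_le_eq)
    moreover have "1 * \<bar>D x - D y\<bar> \<le> a * \<bar>D x - D y\<bar>"
      using a by (intro mult_right_mono) auto
    ultimately show "w \<in> {(x, y) \<in> P \<times> P. \<bar>D x - D y\<bar> \<le> T}"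
      using w by auto
  qed (use fin in \<open>auto intro: finite_subset[of _ "P \<times> P"]\<close>)
  \<comment> \<open>The shift is absorbed into the second function, which has the same
    self-coincidences as \<open>f b\<close>.\<close>
  have shifted: "card {(x, y) \<in> P \<times> P. f a x = f b y + e} \<le> ?E" for e
  proof -
    have "2 * card {(x, y) \<in> P \<times> P. f a x = f b y + e} \<le>
      card {(x, y) \<in> P \<times> P. f a x = f a y} + card {(x, y) \<in> P \<times> P. f b x + e = f b y + e}"
      by (rule card_coincidences_le[OF fin])
    also have "\<dots> \<le> ?E + ?E"
      using same[OF ab(1)] same[OF ab(2)] by (intro add_mono) simp_all
    finally show ?thesis by simp
  qed
  \<comment> \<open>Values within T of each other lie in the same bin or in adjacent ones. The three
    possible shifts are the source of the factor 3.\<close>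
  have "{(x, y) \<in> P \<times> P. \<bar>a * D x - b * D y\<bar> \<le> T} \<subseteq>
    (\<Union>e\<in>{-1, 0, 1}. {(x, y) \<in> P \<times> P. f a x = f b y + e})"
  proof
    fix w assume "w \<in> {(x, y) \<in> P \<times> P. \<bar>a * D x - b * D y\<bar> \<le> T}"
    then obtain x y where w: "w = (x, y)" "x \<in> P" "y \<in> P" "\<bar>a * D x - b * D y\<bar> \<le> T" by auto
    have "\<bar>a * D x / T - b * D y / T\<bar> \<le> 1"
      using w(4) T by (simp flip: diff_divide_distrib)
    then have "f a x - f b y \<in> {-1, 0, 1}"
      unfolding f_def by (simp, linarith)
    then show "w \<in> (\<Union>e\<in>{-1, 0, 1}. {(x, y) \<in> P \<times> P. f a x = f b y + e})"
      using w by auto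
  qed
  then have "card {(x, y) \<in> P \<times> P. \<bar>a * D x - b * D y\<bar> \<le> T} \<le>
    card (\<Union>e\<in>{-1, 0, 1}. {(x, y) \<in> P \<times> P. f a x = f b y + e})"
    using fin by (intro card_mono) (auto intro: finite_subset[of _ "P \<times> P"])
  also have "\<dots> \<le> (\<Sum>e\<in>{-1, 0, 1}. card {(x, y) \<in> P \<times> P. f a x = f b y + e})"
    by (rule card_UN_le) simp
  also have "\<dots> \<le> (\<Sum>e\<in>{-1, 0, 1 :: int}. ?E)"
    by (intro sum_mono shifted)
  finally show ?thesis by simp
qed

lemma eventually_powr_less:
  fixes a b c :: real
  assumes "a < b"
  shows "\<forall>\<^sub>F N in sequentially. c * real N powr a < real N powr b"
proof -
  have "filterlim (\<lambda>N. real N powr (b - a)) at_top sequentially"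
    using assms by real_asymp
  then have "\<forall>\<^sub>F N in sequentially. c < real N powr (b - a)"
    by (simp add: filterlim_at_top_dense)
  moreover have "\<forall>\<^sub>F N in sequentially. 0 < N"
    by (rule eventually_gt_at_top)
  ultimately show ?thesis
  proof eventually_elim
    case (elim N)
    then have "c * real N powr a < real N powr (b - a) * real N powr a"
      by (intro mult_strict_right_mono) auto
    then show ?case
      by (simp flip: powr_add)
  qed
qed

text \<open>L = N^(1 - \<kappa>), and A of size N^(1/4) balances N / A against A^3. Both become
  N^(3/4), which is at most L because \<kappa> \<le> 1/4, so every term is O(N^2 L). The
  inequalities \<open>e1\<close> and \<open>e2\<close> express \<open>gap\<close> and
  \<open>big\<close> in exponents. The slack in \<open>e2\<close> is p - 2 - 2 \<kappa> p + \<kappa>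
  - \<tau>, positive since 4 \<kappa> p \<le> p - 2 and \<tau> \<le> \<kappa>; this is the place
  where p must exceed 2.\<close>

lemma eventually_energy_le:
  fixes p \<kappa> \<tau> :: real
  assumes p: "2 \<le> p" and \<kappa>: "0 < \<kappa>" "\<kappa> \<le> 1 / 4" "4 * \<kappa> * p \<le> p - 2" and \<tau>: "0 < \<tau>" "\<tau> \<le> \<kappa>"
  shows "\<forall>\<^sub>F N in sequentially.
    real (card {(w, w') \<in> large_pairs (real N powr (1 - \<kappa>)) N \<times> large_pairs (real N powr (1 - \<kappa>)) N.
      \<bar>powr_gap p w - powr_gap p w'\<bar> \<le> real N powr \<tau>}) \<le> 6 * real N powr (3 - \<kappa>)"
proof -
  have \<kappa>p: "8 * \<kappa> \<le> 4 * \<kappa> * p"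
    using p \<kappa> by (simp add: mult_left_mono)
  have e1: "\<tau> < (1 - \<kappa>) * (p - 1)" and e2: "\<tau> + 2 + \<kappa> * (p - 1) < (1 - \<kappa>) * p"
  proof -
    have "0 < p - 1 - \<kappa> * p + \<kappa> - \<tau>" "0 < p - \<kappa> * p - (\<tau> + 2 + (\<kappa> * p - \<kappa>))"
      using \<kappa> \<tau> p \<kappa>p by linarith+
    then show "\<tau> < (1 - \<kappa>) * (p - 1)" "\<tau> + 2 + \<kappa> * (p - 1) < (1 - \<kappa>) * p"
      by (simp_all add: algebra_simps)
  qed
  have "\<forall>\<^sub>F N in sequentially. 2 * real N powr \<tau> < real N powr ((1 - \<kappa>) * (p - 1))"
    by (rule eventually_powr_less[OF e1])
  moreover have "\<forall>\<^sub>F N in sequentially. 8 * real N powr (\<tau> + 2 + \<kappa> * (p - 1)) < real N powr ((1 - \<kappa>) * p)"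
    by (rule eventually_powr_less[OF e2])
  moreover have "\<forall>\<^sub>F N in sequentially. 2 * real N powr (1 / 4) < real N powr (1 - \<kappa>)"
    by (rule eventually_powr_less) (use \<kappa> in auto)
  moreover have "\<forall>\<^sub>F N in sequentially. 0 < N"
    by (rule eventually_gt_at_top)
  ultimately show ?thesis
  proof eventually_elim
    case (elim N)
    define L where "L = real N powr (1 - \<kappa>)"
    define A where "A = nat \<lfloor>real N powr (1 / 4)\<rfloor>"
    have N1: "1 \<le> real N"
      using elim by simp
    have q1: "1 \<le> real N powr (1 / 4)"
      using N1 by (simp add: ge_one_powr_ge_zero)
    have A: "1 \<le> A" "real A \<le> real N powr (1 / 4)" "real N powr (1 / 4) \<le> 2 * real A"
    proof -
      have "1 \<le> \<lfloor>real N powr (1 / 4)\<rfloor>"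
        using q1 by simp
      moreover from this have "real A = of_int \<lfloor>real N powr (1 / 4)\<rfloor>"
        by (simp add: A_def)
      ultimately show "1 \<le> A" "real A \<le> real N powr (1 / 4)" "real N powr (1 / 4) \<le> 2 * real A"
        by linarith+
    qed
    have "real (card {(w, w') \<in> large_pairs L N \<times> large_pairs L N.
        \<bar>powr_gap p w - powr_gap p w'\<bar> \<le> real N powr \<tau>})
      \<le> (real N)\<^sup>2 * (real N / real A + 1 + real A ^ 3) + 2 * (real N)\<^sup>2 * L"
    proof (rule card_energy_le)
      show "2 * real A \<le> L"
        using A elim by (simp add: L_def)
      show "2 * real N powr \<tau> < L powr (p - 1)"
        using elim by (simp add: L_def powr_powr)
      have "real N / L = real N powr \<kappa>"
        using N1 by (simp add: L_def powr_diff)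
      then have "8 * real N powr \<tau> * (real N)\<^sup>2 * (real N / L) powr (p - 1)
        = 8 * real N powr (\<tau> + 2 + \<kappa> * (p - 1))"
        using N1 by (simp add: powr_add powr_powr powr_numeral)
      then show "8 * real N powr \<tau> * (real N)\<^sup>2 * (real N / L) powr (p - 1) < L powr p"
        using elim by (simp add: L_def powr_powr)
    qed (use p A N1 in \<open>auto simp: L_def\<close>)
    also have "\<dots> \<le> (real N)\<^sup>2 * (2 * L + L + L) + 2 * (real N)\<^sup>2 * L"
    proof (intro add_right_mono mult_left_mono add_mono)
      have le: "real N powr (3 / 4) \<le> L"
        unfolding L_def using N1 \<kappa> by (intro powr_mono) auto
      have "real N / real A \<le> real N / (real N powr (1 / 4) / 2)"
        using A q1 N1 by (intro divide_left_mono mult_pos_pos) auto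
      also have "\<dots> = 2 * real N powr (3 / 4)"
        using N1 powr_add[of "real N" "1 / 4" "3 / 4"] by (simp add: field_simps)
      finally show "real N / real A \<le> 2 * L"
        using le by simp
      show "1 \<le> L"
        unfolding L_def using N1 \<kappa> by (intro ge_one_powr_ge_zero) auto
      have "real A ^ 3 \<le> (real N powr (1 / 4)) ^ 3"
        using A by (intro power_mono) auto
      also have "\<dots> = real N powr (3 / 4)"
        using N1 by (simp add: powr_power)
      finally show "real A ^ 3 \<le> L"
        using le by simp
    qed auto
    also have "\<dots> = 6 * real N powr (3 - \<kappa>)"
      using N1 powr_add[of "real N" 2 "1 - \<kappa>"] by (simp add: L_def powr_numeral)
    finally show ?case
      by (simp add: L_def)
  qed
qed

section \<open>Nearness to integers in one coordinate\<close>

definition nint :: "real \<Rightarrow> real" where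
  "nint z = \<bar>z - of_int (round z)\<bar>"

lemma nint_le_iff: "nint z \<le> d \<longleftrightarrow> (\<exists>k::int. \<bar>z - of_int k\<bar> \<le> d)"
  unfolding nint_def using round_diff_minimal order_trans by metis

lemma nint_minus [simp]: "nint (- z) = nint z"
proof -
  have "nint (- z) \<le> nint z" for z
  proof -
    have "\<bar>- z - of_int (- round z)\<bar> \<le> nint z"
      by (simp add: nint_def)
    then show ?thesis
      unfolding nint_le_iff by blast
  qed
  from this[of z] this[of "- z"] show ?thesis by simp
qed

lemma nint_add_of_int [simp]: "nint (z + of_int k) = nint z"
proof -
  have "\<lfloor>z + of_int k + 1 / 2\<rfloor> = \<lfloor>z + 1 / 2\<rfloor> + k"
    by linarith
  then show ?thesis
    by (simp add: nint_def round_def)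
qed

lemma nint_frac_diff: "nint (frac x - frac y) = nint (x - y)"
proof -
  have "frac x - frac y = (x - y) + of_int (\<lfloor>y\<rfloor> - \<lfloor>x\<rfloor>)"
    by (simp add: frac_def)
  then show ?thesis
    by (simp only: nint_add_of_int)
qed

lemma measurable_nint [measurable]: "nint \<in> borel_measurable borel"
proof -
  have "nint = (\<lambda>z. \<bar>z - real_of_int \<lfloor>z + 1 / 2\<rfloor>\<bar>)"
    by (auto simp: nint_def round_def)
  also have "\<dots> \<in> borel_measurable borel"
    by measurable
  finally show ?thesis .
qed

section \<open>Visits of a rotation to a short interval\<close>

lemma card_int_interval_le:
  fixes u v :: real and S :: "int set"
  assumes "\<And>j. j \<in> S \<Longrightarrow> u \<le> of_int j \<and> of_int j \<le> v" "u \<le> v"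
  shows "real (card S) \<le> v - u + 1"
proof -
  have "S \<subseteq> {\<lceil>u\<rceil>..\<lfloor>v\<rfloor>}"
    using assms(1) by (auto simp: le_floor_iff ceiling_le_iff)
  then have "card S \<le> nat (\<lfloor>v\<rfloor> - \<lceil>u\<rceil> + 1)"
    using card_mono[of "{\<lceil>u\<rceil>..\<lfloor>v\<rfloor>}" S] by simp
  moreover have "real (nat (\<lfloor>v\<rfloor> - \<lceil>u\<rceil> + 1)) \<le> v - u + 1"
    using assms(2) by linarith
  ultimately show ?thesis
    by (meson of_nat_le_iff order_trans)
qed

text \<open>With \<open>m j\<close> the integer nearest to \<beta> j + \<gamma>, the integer F j =
  (j - i) h - k (m j) is congruent to (j - i) h modulo k, so F is injective on k consecutive j.
  Replacing \<beta> by h / k over at most k steps costs at most k e, so F j lies within k (d + e) of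
  - k (\<beta> i + \<gamma>), and it remains to count integers in an interval.\<close>

lemma card_rotation_block_le:
  fixes \<beta> \<gamma> d e :: real and h k i :: int
  assumes hk: "coprime h k" "0 < k" and e: "\<bar>of_int k * \<beta> - of_int h\<bar> \<le> e" and d: "0 \<le> d"
  shows "real (card {j \<in> {i..<i + k}. nint (\<beta> * of_int j + \<gamma>) \<le> d}) \<le> 2 * of_int k * (d + e) + 1"
proof -
  define S where "S = {j \<in> {i..<i + k}. nint (\<beta> * of_int j + \<gamma>) \<le> d}"
  define m where "m j = round (\<beta> * of_int j + \<gamma>)" for j :: int
  define F where "F j = (j - i) * h - k * m j" for j
  define g where "g = \<beta> * of_int i + \<gamma>"
  have "0 \<le> e"
    using e by linarith
  have inj: "inj_on F S"
  proof (rule inj_onI)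
    fix j l assume jl: "j \<in> S" "l \<in> S" "F j = F l"
    then have "(j - l) * h = k * (m j - m l)"
      by (simp add: F_def algebra_simps)
    then have "k dvd (j - l) * h"
      by simp
    then have "k dvd j - l"
      using hk(1) by (simp add: coprime_commute coprime_dvd_mult_left_iff)
    moreover have "\<bar>j - l\<bar> < k"
      using jl by (auto simp: S_def)
    ultimately show "j = l"
      using zdvd_not_zless zdvd_imp_le by (metis abs_of_pos dvd_imp_le_int eq_iff_diff_eq_0 hk(2) not_le)
  qed
  have F: "of_int k * (- g - (d + e)) \<le> of_int (F j) \<and> of_int (F j) \<le> of_int k * (- g + (d + e))"
    if "j \<in> S" for j
  proof -
    define t where "t = real_of_int (j - i)"
    have t: "0 \<le> t" "t \<le> of_int k" "real_of_int j = of_int i + t"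
      using that by (auto simp: t_def S_def)
    have 1: "\<bar>of_int k * (\<beta> * of_int j + \<gamma> - of_int (m j))\<bar> \<le> of_int k * d"
      using that hk by (simp add: abs_mult S_def nint_def m_def mult_left_mono)
    have "\<bar>t * (of_int k * \<beta> - of_int h)\<bar> \<le> of_int k * e"
      unfolding abs_mult using t e \<open>0 \<le> e\<close> by (intro mult_mono) auto
    moreover have "of_int (F j) + of_int k * g
      = of_int k * (\<beta> * of_int j + \<gamma> - of_int (m j)) - t * (of_int k * \<beta> - of_int h)"
      by (simp add: F_def g_def t(3) algebra_simps flip: t_def)
    ultimately have "\<bar>of_int (F j) + of_int k * g\<bar> \<le> of_int k * d + of_int k * e"
      using 1 by linarith
    then show ?thesis
      by (simp add: algebra_simps abs_le_iff)
  qed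
  have "card S = card (F ` S)"
    using inj by (simp add: card_image)
  moreover have "real (card (F ` S)) \<le> of_int k * (- g + (d + e)) - of_int k * (- g - (d + e)) + 1"
    using F hk d \<open>0 \<le> e\<close> by (intro card_int_interval_le) (auto intro!: mult_left_mono)
  ultimately show ?thesis
    by (simp add: S_def algebra_simps)
qed

lemma card_rotation_le:
  fixes \<beta> \<gamma> d e :: real and h k i :: int and n :: nat
  assumes hk: "coprime h k" "0 < k" and e: "\<bar>of_int k * \<beta> - of_int h\<bar> \<le> e" and d: "0 \<le> d"
  shows "real (card {j \<in> {i..<i + int n}. nint (\<beta> * of_int j + \<gamma>) \<le> d})
    \<le> (real n / of_int k + 1) * (2 * of_int k * (d + e) + 1)"
proof -
  let ?B = "\<lambda>i. {j \<in> {i..<i + k}. nint (\<beta> * of_int j + \<gamma>) \<le> d}"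
  define M where "M = n div nat k"
  have finB: "finite (?B i)" for i
    by (rule finite_subset[of _ "{i..<i + k}"]) auto
  \<comment> \<open>The last block may stick out of the window, which accounts for the summand 1
    beside n / k.\<close>
  have "{j \<in> {i..<i + int n}. nint (\<beta> * of_int j + \<gamma>) \<le> d} \<subseteq> (\<Union>q\<le>M. ?B (i + int q * k))"
  proof
    fix j assume j: "j \<in> {j \<in> {i..<i + int n}. nint (\<beta> * of_int j + \<gamma>) \<le> d}"
    define q where "q = nat (j - i) div nat k"
    have "int q = (j - i) div k"
      using j hk(2) by (simp add: q_def zdiv_int)
    then have "j = i + int q * k + (j - i) mod k"
      by simp
    moreover have "0 \<le> (j - i) mod k" "(j - i) mod k < k"
      using hk(2) by auto
    ultimately have "j \<in> ?B (i + int q * k)"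
      using j by auto
    moreover have "q \<le> M"
      unfolding q_def M_def using j by (intro div_le_mono) auto
    ultimately show "j \<in> (\<Union>q\<le>M. ?B (i + int q * k))"
      by blast
  qed
  then have "card {j \<in> {i..<i + int n}. nint (\<beta> * of_int j + \<gamma>) \<le> d}
      \<le> card (\<Union>q\<le>M. ?B (i + int q * k))"
    by (intro card_mono finite_UN_I finB) auto
  also have "\<dots> \<le> (\<Sum>q\<le>M. card (?B (i + int q * k)))"
    by (rule card_UN_le) simp
  finally have "real (card {j \<in> {i..<i + int n}. nint (\<beta> * of_int j + \<gamma>) \<le> d})
      \<le> (\<Sum>q\<le>M. real (card (?B (i + int q * k))))"
    by (simp flip: of_nat_sum)
  also have "\<dots> \<le> (\<Sum>q\<le>M. 2 * of_int k * (d + e) + 1)"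
    by (intro sum_mono card_rotation_block_le[OF hk e d])
  also have "\<dots> = (real M + 1) * (2 * of_int k * (d + e) + 1)"
    by simp
  also have "\<dots> \<le> (real n / of_int k + 1) * (2 * of_int k * (d + e) + 1)"
  proof (intro mult_right_mono add_right_mono)
    show "real M \<le> real n / of_int k"
      using of_nat_div_le_of_nat[of n "nat k", where 'a = real] hk(2) by (simp add: M_def)
    show "0 \<le> 2 * real_of_int k * (d + e) + 1"
      using hk(2) d e by auto
  qed
  finally show ?thesis .
qed

section \<open>Measures of single and joint near-integer sets\<close>

definition near_int_set :: "real \<Rightarrow> real \<Rightarrow> real \<Rightarrow> real set" where
  "near_int_set c d D = {x \<in> {c..c + 1}. nint (D * x) \<le> d}"

lemma near_int_set_sets [measurable]: "near_int_set c d D \<in> sets borel"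
  unfolding near_int_set_def by measurable

lemma fmeasurable_near_int_set: "near_int_set c d D \<in> fmeasurable lborel"
  by (rule fmeasurableI2[OF fmeasurable_cbox[of c "c + 1"]]) (auto simp: near_int_set_def)

text \<open>The first set is covered by the pieces x = (j + t) / D with |t| \<le> d, where j runs
  over the integers that can occur for x in [c, c + 1]. After this substitution and an exchange of
  sum and integral, one counts for each t the j at which the rotation by D' / D with phase D' t / D
  is within d of an integer. A bound K uniform in the phase, the length 2 d of the range of t and
  the Jacobian 1 / D give the estimate.\<close>

lemma measure_near_int_set_Int_le:
  fixes c d D D' K :: real
  assumes D: "0 < D" and d: "0 \<le> d"
    and K: "\<And>\<gamma>. real (card {j \<in> {\<lceil>c * D - d\<rceil>..\<lfloor>c * D + D + d\<rfloor>}. nint (D' / D * of_int j + \<gamma>) \<le> d}) \<le> K"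
  shows "measure lborel (near_int_set c d D \<inter> near_int_set c d D') \<le> 2 * d * K / D"
proof -
  define J where "J = {\<lceil>c * D - d\<rceil>..\<lfloor>c * D + D + d\<rfloor>}"
  define f where "f j x = indicator {- d..d} (D * x - of_int j) * (indicator {..d} (nint (D' * x)) :: ennreal)"
    for j :: int and x
  have [measurable]: "f j \<in> borel_measurable borel" for j
    unfolding f_def by measurable
  have "0 \<le> K"
    using K[of 0] by (meson of_nat_0_le_iff order_trans)
  have "emeasure lborel (near_int_set c d D \<inter> near_int_set c d D')
      = (\<integral>\<^sup>+x. indicator (near_int_set c d D \<inter> near_int_set c d D') x \<partial>lborel)"
    by simp
  also have "\<dots> \<le> (\<integral>\<^sup>+x. (\<Sum>j\<in>J. f j x) \<partial>lborel)"
  proof (intro nn_integral_mono)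
    fix x
    show "indicator (near_int_set c d D \<inter> near_int_set c d D') x \<le> (\<Sum>j\<in>J. f j x)"
    proof (cases "x \<in> near_int_set c d D \<inter> near_int_set c d D'")
      case True
      then have x: "c \<le> x" "x \<le> c + 1" "nint (D * x) \<le> d" "nint (D' * x) \<le> d"
        by (auto simp: near_int_set_def)
      obtain j :: int where j: "\<bar>D * x - of_int j\<bar> \<le> d"
        using x(3) nint_le_iff by blast
      have "D * c \<le> D * x" "D * x \<le> D * (c + 1)"
        using x D by (auto intro: mult_left_mono)
      then have "j \<in> J"
        using j by (auto simp: J_def ceiling_le_iff le_floor_iff algebra_simps)
      then have "f j x \<le> (\<Sum>j\<in>J. f j x)"
        by (intro member_le_sum) (auto simp: J_def)
      moreover have "f j x = 1"
        using j x by (auto simp: f_def indicator_def)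
      ultimately show ?thesis
        using True by simp
    qed simp
  qed
  also have "\<dots> = (\<Sum>j\<in>J. \<integral>\<^sup>+x. f j x \<partial>lborel)"
    by (subst nn_integral_sum) auto
  also have "\<dots> = (\<Sum>j\<in>J. ennreal (1 / D) * (\<integral>\<^sup>+t. f j (of_int j / D + 1 / D * t) \<partial>lborel))"
  proof (intro sum.cong refl)
    fix j
    show "(\<integral>\<^sup>+x. f j x \<partial>lborel) = ennreal (1 / D) * (\<integral>\<^sup>+t. f j (of_int j / D + 1 / D * t) \<partial>lborel)"
      using nn_integral_real_affine[of "f j" "1 / D" "of_int j / D"] D by simp
  qed
  also have "\<dots> = ennreal (1 / D) * (\<integral>\<^sup>+t. (\<Sum>j\<in>J. f j (of_int j / D + 1 / D * t)) \<partial>lborel)"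
    by (subst nn_integral_sum) (auto simp: sum_distrib_left)
  also have "\<dots> \<le> ennreal (1 / D) * (\<integral>\<^sup>+t. ennreal K * indicator {- d..d} t \<partial>lborel)"
  proof (intro mult_left_mono nn_integral_mono)
    fix t
    have "(\<Sum>j\<in>J. f j (of_int j / D + 1 / D * t))
      = (\<Sum>j\<in>J. indicator {- d..d} t * indicator {j. nint (D' / D * of_int j + D' / D * t) \<le> d} j)"
      using D by (intro sum.cong refl) (auto simp: f_def indicator_def algebra_simps)
    also have "\<dots> = indicator {- d..d} t * (\<Sum>j\<in>J. indicator {j. nint (D' / D * of_int j + D' / D * t) \<le> d} j)"
      by (rule sum_distrib_left[symmetric])
    also have "(\<Sum>j\<in>J. indicator {j. nint (D' / D * of_int j + D' / D * t) \<le> d} j :: ennreal)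
      = of_nat (card {j \<in> J. nint (D' / D * of_int j + D' / D * t) \<le> d})"
      by (simp add: J_def indicator_def sum.If_cases Int_def)
    also have "indicator {- d..d} t * of_nat (card {j \<in> J. nint (D' / D * of_int j + D' / D * t) \<le> d})
      \<le> indicator {- d..d} t * ennreal K"
      using K[of "D' / D * t"]
      by (intro mult_left_mono) (auto simp: J_def simp flip: ennreal_of_nat_eq_real_of_nat intro: ennreal_leI)
    finally show "(\<Sum>j\<in>J. f j (of_int j / D + 1 / D * t)) \<le> ennreal K * indicator {- d..d} t"
      by (simp add: mult.commute)
  qed auto
  also have "\<dots> = ennreal (2 * d * K / D)"
    using d D \<open>0 \<le> K\<close> by (simp add: nn_integral_cmult_indicator ennreal_mult'[symmetric] mult_ac)
  finally show ?thesis
    using d D \<open>0 \<le> K\<close> by (simp add: measure_def enn2real_leI)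
qed

lemma card_int_interval_ge:
  fixes u v :: real
  shows "v - u - 1 \<le> real (card {\<lceil>u\<rceil>..\<lfloor>v\<rfloor>})"
  by simp linarith

text \<open>At least D - 2 d - 1 \<ge> D - 2 complete intervals of length 2 d / D lie inside
  [c, c + 1], and they are disjoint because 2 d < 1.\<close>

lemma measure_near_int_set_ge:
  fixes c d D :: real
  assumes D: "0 < D" and d: "0 \<le> d" "2 * d < 1"
  shows "2 * d * (1 - 2 / D) \<le> measure lborel (near_int_set c d D)"
proof -
  define J where "J = {\<lceil>c * D + d\<rceil>..\<lfloor>c * D + D - d\<rfloor>}"
  define I where "I j = {(of_int j - d) / D..(of_int j + d) / D}" for j :: int
  have I: "x \<in> I j \<longleftrightarrow> \<bar>D * x - of_int j\<bar> \<le> d" for x j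
    using D by (auto simp: I_def field_simps abs_le_iff)
  have "2 * d * (1 - 2 / D) = (D - 2) * (2 * d / D)"
    using D by (simp add: field_simps)
  also have "\<dots> \<le> real (card J) * (2 * d / D)"
    using card_int_interval_ge[of "c * D + D - d" "c * D + d"] D d
    by (intro mult_right_mono) (auto simp: J_def)
  also have "\<dots> = (\<Sum>j\<in>J. measure lborel (I j))"
    using D d by (simp add: I_def divide_right_mono diff_divide_distrib[symmetric])
  also have "\<dots> = measure lborel (\<Union>j\<in>J. I j)"
  proof (rule measure_finite_Union[symmetric])
    show "disjoint_family_on I J"
      unfolding disjoint_family_on_def
    proof (intro ballI impI)
      fix j l :: int assume "j \<noteq> l"
      show "I j \<inter> I l = {}"
      proof (rule ccontr)
        assume "I j \<inter> I l \<noteq> {}"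
        then obtain x where "\<bar>D * x - of_int j\<bar> \<le> d" "\<bar>D * x - of_int l\<bar> \<le> d"
          unfolding I[symmetric] by blast
        then have "\<bar>real_of_int (j - l)\<bar> < 1"
          using d(2) by simp
        then show False
          using \<open>j \<noteq> l\<close> by linarith
      qed
    qed
  qed (auto simp: I_def J_def emeasure_lborel_Icc_eq)
  also have "\<dots> \<le> measure lborel (near_int_set c d D)"
  proof (rule measure_mono_fmeasurable[OF _ _ fmeasurable_near_int_set])
    show "(\<Union>j\<in>J. I j) \<subseteq> near_int_set c d D"
    proof
      fix x assume "x \<in> (\<Union>j\<in>J. I j)"
      then obtain j where j: "j \<in> J" "\<bar>D * x - of_int j\<bar> \<le> d"
        using I by blast
      then have "c * D + d \<le> of_int j" "of_int j \<le> c * D + D - d"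
        by (auto simp: J_def ceiling_le_iff le_floor_iff)
      then have "c * D \<le> x * D" "x * D \<le> (c + 1) * D"
        using j by (auto simp: algebra_simps abs_le_iff)
      then show "x \<in> near_int_set c d D"
        using D j nint_le_iff by (auto simp: near_int_set_def)
    qed
  qed (auto simp: I_def J_def emeasure_lborel_Icc_eq)
  finally show ?thesis .
qed

lemma card_window_le:
  fixes c d D :: real
  assumes "0 < D" "0 \<le> d" "2 * d \<le> 1"
  shows "real (card {\<lceil>c * D - d\<rceil>..\<lfloor>c * D + D + d\<rfloor>}) \<le> D + 2"
  using card_int_interval_le[of "{\<lceil>c * D - d\<rceil>..\<lfloor>c * D + D + d\<rfloor>}" "c * D - d" "c * D + D + d"] assms
  by (auto simp: ceiling_le_iff le_floor_iff)

lemma measure_near_int_set_le: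
  fixes c d D :: real
  assumes D: "1 \<le> D" and d: "0 \<le> d" "2 * d \<le> 1"
  shows "measure lborel (near_int_set c d D) \<le> 6 * d"
proof -
  \<comment> \<open>For the gap 0 the second condition is void, so the joint bound specialises to a
    single set.\<close>
  have "near_int_set c d D \<inter> near_int_set c d 0 = near_int_set c d D"
    using d by (auto simp: near_int_set_def nint_def)
  moreover have "measure lborel (near_int_set c d D \<inter> near_int_set c d 0) \<le> 2 * d * (D + 2) / D"
  proof (rule measure_near_int_set_Int_le)
    fix \<gamma>
    let ?J = "{\<lceil>c * D - d\<rceil>..\<lfloor>c * D + D + d\<rfloor>}"
    have "card {j \<in> ?J. nint (0 / D * of_int j + \<gamma>) \<le> d} \<le> card ?J"
      by (intro card_mono) auto
    then show "real (card {j \<in> ?J. nint (0 / D * of_int j + \<gamma>) \<le> d}) \<le> D + 2"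
      using card_window_le[of D d c] D d by linarith
  qed (use D d in auto)
  moreover have "2 * d * (D + 2) / D \<le> 6 * d"
  proof -
    have "2 * d * (D + 2) \<le> 2 * d * (3 * D)"
      using D d by (intro mult_left_mono) auto
    then show ?thesis
      using D by (simp add: divide_le_eq mult_ac)
  qed
  ultimately show ?thesis by simp
qed

text \<open>Dirichlet's theorem is applied to D' / D with denominators up to P = ceiling (D / T), so
  that 1 / P \<le> T / D and k \<le> D / T + 1. In the rotation count (n / k + 1) (2 k (d + 1 / P) +
  1), with n about D, the product 2 n d gives the independent value 4 d^2, the term 2 k d gives 4
  d^2 / T, and n / k gives the resonance term 6 d / k. What remains, in particular n / P \<le> 3 T,
  is divided by D in the end.\<close>

lemma measure_near_int_set_pair_le:
  fixes c d D D' T :: real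
  assumes D: "1 \<le> D" and T: "1 \<le> T" and d: "0 \<le> d" "2 * d \<le> 1"
  obtains h k :: int where "0 < k" "\<bar>of_int k * D' - of_int h * D\<bar> \<le> T"
    "measure lborel (near_int_set c d D \<inter> near_int_set c d D')
      \<le> 4 * d\<^sup>2 * (1 + 1 / T) + (12 * d\<^sup>2 + 18 * d * T) / D + 6 * d / of_int k"
proof -
  define P where "P = nat \<lceil>D / T\<rceil>"
  have DT: "0 < D / T"
    using D T by simp
  then have P: "0 < P" "D / T \<le> real P" "real P \<le> D / T + 1"
    unfolding P_def by linarith+
  obtain h k where hk: "coprime h k" "0 < k" "k \<le> int P" "\<bar>of_int k * (D' / D) - of_int h\<bar> < 1 / P"
    using Dirichlet_approx_coprime[OF P(1)] by metis
  define J where "J = {\<lceil>c * D - d\<rceil>..\<lfloor>c * D + D + d\<rfloor>}"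
  have kP: "of_int k \<le> real P"
    using hk(3) by (metis of_int_le_iff of_int_of_nat_eq)
  have k1: "1 \<le> real_of_int k"
    using hk(2) by simp
  have PT: "1 / P \<le> T / D"
  proof -
    have "D * 1 \<le> T * real P"
      using P(2) T by (simp add: divide_le_eq mult.commute)
    then show ?thesis
      using P D by (simp add: divide_simps mult.commute)
  qed
  have kDT: "\<bar>of_int k * D' - of_int h * D\<bar> \<le> T"
  proof -
    have "of_int k * D' - of_int h * D = (of_int k * (D' / D) - of_int h) * D"
      using D by (simp add: left_diff_distrib)
    then have "\<bar>of_int k * D' - of_int h * D\<bar> = \<bar>of_int k * (D' / D) - of_int h\<bar> * D"
      using D by (simp add: abs_mult)
    also have "\<dots> \<le> T / D * D"
      using hk(4) PT D by (intro mult_right_mono) auto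
    finally show ?thesis
      using D by simp
  qed
  define K where "K = 2 * (D + 2) * d + 6 * T + (D + 2) / of_int k + 2 * (D / T + 1) * d + 3"
  have "measure lborel (near_int_set c d D \<inter> near_int_set c d D') \<le> 2 * d * K / D"
  proof (rule measure_near_int_set_Int_le)
    fix \<gamma>
    define n where "n = card J"
    have n: "real n \<le> D + 2"
      using card_window_le[of D d c] D d by (simp add: n_def J_def)
    have J: "J = {\<lceil>c * D - d\<rceil>..<\<lceil>c * D - d\<rceil> + int n}"
    proof -
      have "\<lceil>c * D - d\<rceil> \<le> \<lfloor>c * D + D + d\<rfloor> + 1"
        using D d by linarith
      then show ?thesis
        by (auto simp: n_def J_def)
    qed
    have "real (card {j \<in> J. nint (D' / D * of_int j + \<gamma>) \<le> d})
      \<le> (real n / of_int k + 1) * (2 * of_int k * (d + 1 / P) + 1)"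
      unfolding J using hk d by (intro card_rotation_le) auto
    also have "\<dots> = 2 * real n * d + 2 * (real n * (1 / P)) + real n / of_int k + 2 * of_int k * d
        + 2 * (of_int k / P) + 1"
      using k1 P by (simp add: field_simps)
    also have "\<dots> \<le> 2 * (D + 2) * d + 2 * (3 * T) + (D + 2) / of_int k + 2 * (D / T + 1) * d + 2 * 1 + 1"
    proof (intro add_mono mult_right_mono mult_left_mono divide_right_mono)
      have "real n * (1 / P) \<le> (D + 2) * (T / D)"
        using n PT D by (intro mult_mono) auto
      also have "\<dots> \<le> (3 * D) * (T / D)"
        using D T by (intro mult_right_mono) auto
      finally show "real n * (1 / P) \<le> 3 * T"
        using D by simp
      show "of_int k / real P \<le> 1"
        using kP P by simp
      show "of_int k \<le> D / T + 1"
        using kP P by linarith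
    qed (use n d k1 in auto)
    finally show "real (card {j \<in> {\<lceil>c * D - d\<rceil>..\<lfloor>c * D + D + d\<rfloor>}. nint (D' / D * of_int j + \<gamma>) \<le> d}) \<le> K"
      by (simp add: K_def J_def)
  qed (use D d in auto)
  also have "2 * d * K / D = 4 * d\<^sup>2 * (1 + 1 / T) + (12 * d\<^sup>2 + 12 * d * T + 6 * d) / D
      + 2 * d * ((D + 2) / D) / of_int k"
    using D T k1 by (simp add: K_def field_simps power2_eq_square)
  also have "\<dots> \<le> 4 * d\<^sup>2 * (1 + 1 / T) + (12 * d\<^sup>2 + 18 * d * T) / D + 2 * d * 3 / of_int k"
  proof -
    have "1 * d \<le> T * d"
      using d T by (intro mult_right_mono) auto
    then have "(12 * d\<^sup>2 + 12 * d * T + 6 * d) / D \<le> (12 * d\<^sup>2 + 18 * d * T) / D"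
      using D by (intro divide_right_mono) auto
    moreover have "2 * d * ((D + 2) / D) / of_int k \<le> 2 * d * 3 / of_int k"
      using D d k1 by (intro divide_right_mono mult_left_mono) (auto simp: divide_le_eq)
    ultimately show ?thesis
      by linarith
  qed
  finally show ?thesis
    using that[OF hk(2) kDT] by simp
qed

section \<open>Second moment of the pair count\<close>

lemma Basis_vec_real: "(Basis :: (real ^ 'd::finite) set) = range (\<lambda>i. axis i 1)"
  by (auto simp: Basis_vec_def)

lemma sets_vec_box [measurable]:
  fixes S :: "'d::finite \<Rightarrow> real set"
  assumes [measurable]: "\<And>i. S i \<in> sets borel"
  shows "{x :: real ^ 'd. \<forall>i. x $ i \<in> S i} \<in> sets borel"
proof -
  have "{x :: real ^ 'd. \<forall>i. x $ i \<in> S i} = {x \<in> space borel. \<forall>i\<in>UNIV. x $ i \<in> S i}"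
    by auto
  also have "\<dots> \<in> sets borel"
    by measurable
  finally show ?thesis .
qed

lemma emeasure_vec_box:
  fixes S :: "'d::finite \<Rightarrow> real set"
  assumes S [measurable]: "\<And>i. S i \<in> sets borel"
  shows "emeasure lborel {x :: real ^ 'd. \<forall>i. x $ i \<in> S i} = (\<Prod>i\<in>UNIV. emeasure lborel (S i))"
proof -
  \<comment> \<open>\<open>j\<close> recovers the index of an axis vector and only serves to turn
    products over \<open>Basis\<close> into products over coordinates.\<close>
  define j where "j b = (THE i. b = axis i (1 :: real))" for b :: "real ^ 'd"
  define f :: "real ^ 'd \<Rightarrow> real \<Rightarrow> ennreal" where "f b = indicator (S (j b))" for b
  have j: "j (axis i 1) = i" for i
    unfolding j_def by (rule the_equality) (auto simp: axis_eq_axis)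
  have inj: "inj (\<lambda>i :: 'd. axis i (1 :: real))"
    by (rule injI) (simp add: axis_eq_axis)
  have "emeasure lborel {x :: real ^ 'd. \<forall>i. x $ i \<in> S i}
      = (\<integral>\<^sup>+x. indicator {x :: real ^ 'd. \<forall>i. x $ i \<in> S i} x \<partial>lborel)"
    using S by simp
  also have "\<dots> = (\<integral>\<^sup>+x. (\<Prod>b\<in>Basis. f b (x \<bullet> b)) \<partial>lborel)"
  proof (intro nn_integral_cong)
    fix x :: "real ^ 'd"
    have "(\<Prod>b\<in>Basis. f b (x \<bullet> b)) = (\<Prod>i\<in>UNIV. indicator (S i) (x $ i))"
      by (simp add: Basis_vec_real prod.reindex[OF inj] f_def j inner_axis)
    also have "\<dots> = indicator {x :: real ^ 'd. \<forall>i. x $ i \<in> S i} x"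
      by (auto simp: indicator_def prod_zero_iff)
    finally show "indicator {x :: real ^ 'd. \<forall>i. x $ i \<in> S i} x = (\<Prod>b\<in>Basis. f b (x \<bullet> b))" ..
  qed
  also have "\<dots> = (\<Prod>b\<in>Basis. \<integral>\<^sup>+x. f b x \<partial>lborel)"
    by (intro nn_integral_lborel_prod) (auto simp: f_def)
  also have "\<dots> = (\<Prod>i\<in>UNIV. emeasure lborel (S i))"
    by (simp add: Basis_vec_real prod.reindex[OF inj] f_def j)
  finally show ?thesis .
qed

lemma measure_vec_box:
  fixes S :: "'d::finite \<Rightarrow> real set"
  assumes "\<And>i. S i \<in> fmeasurable lborel"
  shows "measure lborel {x :: real ^ 'd. \<forall>i. x $ i \<in> S i} = (\<Prod>i\<in>UNIV. measure lborel (S i))"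
proof -
  have "\<And>i. S i \<in> sets borel"
    using assms fmeasurableD by force
  then have "emeasure lborel {x :: real ^ 'd. \<forall>i. x $ i \<in> S i} = (\<Prod>i\<in>UNIV. emeasure lborel (S i))"
    by (rule emeasure_vec_box)
  also have "\<dots> = (\<Prod>i\<in>UNIV. ennreal (measure lborel (S i)))"
    using assms by (simp add: emeasure_eq_measure2)
  also have "\<dots> = ennreal (\<Prod>i\<in>UNIV. measure lborel (S i))"
    by (simp add: prod_ennreal)
  finally show ?thesis
    by (simp add: measure_def prod_nonneg)
qed

lemma (in prob_space) integral_square_sum_indicator:
  assumes fin: "finite B" and V: "\<And>w. w \<in> B \<Longrightarrow> V w \<in> events"
  shows "integrable M (\<lambda>x. ((\<Sum>w\<in>B. indicator (V w) x) - t)\<^sup>2 :: real)"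
    and "(\<integral>x. ((\<Sum>w\<in>B. indicator (V w) x) - t)\<^sup>2 \<partial>M)
      = (\<Sum>w\<in>B. \<Sum>w'\<in>B. prob (V w \<inter> V w')) - 2 * t * (\<Sum>w\<in>B. prob (V w)) + t\<^sup>2"
proof -
  have int: "integrable M (indicator (V w) :: _ \<Rightarrow> real)" if "w \<in> B" for w
    using V[OF that] by (simp add: integrable_real_indicator emeasure_eq_measure)
  have int2: "integrable M (indicator (V w \<inter> V w') :: _ \<Rightarrow> real)" if "w \<in> B" "w' \<in> B" for w w'
    using V[OF that(1)] V[OF that(2)] by (simp add: integrable_real_indicator emeasure_eq_measure)
  have eq: "((\<Sum>w\<in>B. indicator (V w) x) - t)\<^sup>2
    = (\<Sum>w\<in>B. \<Sum>w'\<in>B. indicator (V w \<inter> V w') x) - 2 * t * (\<Sum>w\<in>B. indicator (V w) x) + t\<^sup>2" for x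
    by (simp add: power2_diff power2_eq_square sum_product indicator_inter_arith algebra_simps)
  show "integrable M (\<lambda>x. ((\<Sum>w\<in>B. indicator (V w) x) - t)\<^sup>2 :: real)"
    unfolding eq using int int2
    by (intro Bochner_Integration.integrable_add Bochner_Integration.integrable_diff
        Bochner_Integration.integrable_sum integrable_mult_right) auto
  show "(\<integral>x. ((\<Sum>w\<in>B. indicator (V w) x) - t)\<^sup>2 \<partial>M)
      = (\<Sum>w\<in>B. \<Sum>w'\<in>B. prob (V w \<inter> V w')) - 2 * t * (\<Sum>w\<in>B. prob (V w)) + t\<^sup>2"
    unfolding eq using int int2 V
    by (simp add: Bochner_Integration.integral_sum integrable_mult_right prob_space)
qed

text \<open>By symmetry let D' be the smaller gap. Then k D' \<ge> Dmin > T forces h > 0, and h D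
  \<le> k D' + T < (k + 1) D forces h \<le> k. The disjunction in the conclusion records which gap
  was the larger one.\<close>

lemma near_int_pair_resonance:
  fixes c d D D' T Dmin :: real
  assumes T: "1 \<le> T" and Dmin: "T < Dmin" "Dmin \<le> D" "Dmin \<le> D'" and d: "0 \<le> d" "2 * d \<le> 1"
  obtains h k :: nat where "1 \<le> h" "h \<le> k"
    "\<bar>real k * D' - real h * D\<bar> \<le> T \<or> \<bar>real k * D - real h * D'\<bar> \<le> T"
    "measure lborel (near_int_set c d D \<inter> near_int_set c d D')
      \<le> 4 * d\<^sup>2 * (1 + 1 / T) + (12 * d\<^sup>2 + 18 * d * T) / Dmin + 6 * d / real k"
proof -
  have *: thesis if DD: "Dmin \<le> D" "Dmin \<le> D'" "D' \<le> D" and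
    that: "\<And>h k. 1 \<le> h \<Longrightarrow> h \<le> k \<Longrightarrow> \<bar>real k * D' - real h * D\<bar> \<le> T \<Longrightarrow>
      measure lborel (near_int_set c d D \<inter> near_int_set c d D')
      \<le> 4 * d\<^sup>2 * (1 + 1 / T) + (12 * d\<^sup>2 + 18 * d * T) / Dmin + 6 * d / real k \<Longrightarrow> thesis" for D D' thesis
  proof -
    have "1 \<le> D"
      using T Dmin DD by linarith
    then obtain h k :: int where hk: "0 < k" "\<bar>of_int k * D' - of_int h * D\<bar> \<le> T"
      "measure lborel (near_int_set c d D \<inter> near_int_set c d D')
        \<le> 4 * d\<^sup>2 * (1 + 1 / T) + (12 * d\<^sup>2 + 18 * d * T) / D + 6 * d / of_int k"
      using measure_near_int_set_pair_le[OF _ T d] by metis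
    have "1 * D' \<le> of_int k * D'"
      using hk(1) T Dmin DD by (intro mult_right_mono) auto
    then have "0 < of_int h * D"
      using hk(2) Dmin DD by linarith
    then have h: "0 < h"
      using \<open>1 \<le> D\<close> by (simp add: zero_less_mult_iff)
    have "of_int k * D' \<le> of_int k * D"
      using hk(1) DD by (intro mult_left_mono) auto
    then have "of_int h * D < (of_int k + 1) * D"
      using hk(2) Dmin DD unfolding distrib_right by linarith
    then have "real_of_int h < of_int k + 1"
      using \<open>1 \<le> D\<close> by simp
    then have "h \<le> k"
      by linarith
    have "(12 * d\<^sup>2 + 18 * d * T) / D \<le> (12 * d\<^sup>2 + 18 * d * T) / Dmin"
      using T Dmin DD d by (intro divide_left_mono mult_pos_pos) auto
    then show thesis
      using that[of "nat h" "nat k"] hk h \<open>h \<le> k\<close> by simp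
  qed
  show thesis
  proof (cases "D' \<le> D")
    case True
    then show ?thesis
      using *[of D D'] Dmin that by metis
  next
    case False
    then show ?thesis
      using *[of D' D] Dmin that by (metis inf_commute nle_le)
  qed
qed

section \<open>Resonances in several coordinates\<close>

text \<open>All resonances with denominator up to Q are summed, not just the one produced by
  Dirichlet's theorem. The additional terms are nonnegative, and the sum over pairs of gaps can then
  be counted separately for each (h, k).\<close>

definition resonance_weight :: "real \<Rightarrow> real \<Rightarrow> real \<Rightarrow> real \<Rightarrow> real" where
  "resonance_weight T Q D D' = (\<Sum>k = 1..nat \<lfloor>Q\<rfloor>. \<Sum>h = 1..k. 1 / (real k)\<^sup>2 *
     (of_bool (\<bar>real k * D' - real h * D\<bar> \<le> T) + of_bool (\<bar>real k * D - real h * D'\<bar> \<le> T)))"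

lemma resonance_weight_nonneg: "0 \<le> resonance_weight T Q D D'"
  unfolding resonance_weight_def by (intro sum_nonneg mult_nonneg_nonneg) auto

lemma resonance_weight_ge:
  assumes "1 \<le> h" "h \<le> k" "real k \<le> Q"
    and "\<bar>real k * D' - real h * D\<bar> \<le> T \<or> \<bar>real k * D - real h * D'\<bar> \<le> T"
  shows "1 / (real k)\<^sup>2 \<le> resonance_weight T Q D D'"
proof -
  define g where "g k h = 1 / (real k)\<^sup>2 *
     (of_bool (\<bar>real k * D' - real h * D\<bar> \<le> T) + of_bool (\<bar>real k * D - real h * D'\<bar> \<le> T))" for k h :: nat
  have g0: "0 \<le> g k h" for k h
    unfolding g_def by (intro mult_nonneg_nonneg) auto
  have "1 / (real k)\<^sup>2 * 1 \<le> g k h"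
    unfolding g_def using assms(4) by (intro mult_left_mono) auto
  also have "\<dots> \<le> (\<Sum>h = 1..k. g k h)"
    using assms g0 by (intro member_le_sum) auto
  also have "\<dots> \<le> (\<Sum>k = 1..nat \<lfloor>Q\<rfloor>. \<Sum>h = 1..k. g k h)"
    using assms g0 by (intro member_le_sum[where f = "\<lambda>k. \<Sum>h = 1..k. g k h"]) (auto intro!: sum_nonneg simp: le_nat_floor)
  finally show ?thesis
    by (simp add: resonance_weight_def g_def)
qed

text \<open>Among the resonant coordinates the one with the smallest denominator \<open>k\<close> dominates every
  factor of the product measure, so a single coordinate has to be controlled at a time.\<close>

lemma prod_measure_near_int_le:
  fixes c D D' :: "'d::finite \<Rightarrow> real" and d T Dmin Q :: real
  assumes card: "2 \<le> CARD('d)"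
    and T: "1 \<le> T" "T < Dmin" and D: "\<And>i. Dmin \<le> D i" "\<And>i. Dmin \<le> D' i"
    and d: "0 \<le> d" "2 * d \<le> 1" and Q: "0 < Q"
  defines "E \<equiv> 4 * d\<^sup>2 * (1 + 1 / T) + (12 * d\<^sup>2 + 18 * d * T) / Dmin"
  shows "(\<Prod>i\<in>UNIV. measure lborel (near_int_set (c i) d (D i) \<inter> near_int_set (c i) d (D' i)))
    \<le> (E + 6 * d / Q) ^ CARD('d)
      + (Q * E + 6 * d) ^ CARD('d) * (\<Sum>i\<in>UNIV. resonance_weight T Q (D i) (D' i))"
proof -
  define \<mu> where "\<mu> i = measure lborel (near_int_set (c i) d (D i) \<inter> near_int_set (c i) d (D' i))" for i
  have E: "0 \<le> E"
    using T d by (simp add: E_def)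
  have "\<exists>h k :: nat. 1 \<le> h \<and> h \<le> k \<and>
    (\<bar>real k * D' i - real h * D i\<bar> \<le> T \<or> \<bar>real k * D i - real h * D' i\<bar> \<le> T) \<and> \<mu> i \<le> E + 6 * d / real k" for i
    using near_int_pair_resonance[OF T D(1) D(2) d, of i i "c i"] unfolding \<mu>_def E_def by metis
  then obtain h k :: "'d \<Rightarrow> nat" where hk: "\<And>i. 1 \<le> h i" "\<And>i. h i \<le> k i"
    "\<And>i. \<bar>real (k i) * D' i - real (h i) * D i\<bar> \<le> T \<or> \<bar>real (k i) * D i - real (h i) * D' i\<bar> \<le> T"
    "\<And>i. \<mu> i \<le> E + 6 * d / real (k i)"
    by metis
  have k1: "1 \<le> k i" for i
    using hk(1)[of i] hk(2)[of i] by linarith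
  have \<mu>: "0 \<le> \<mu> i" for i
    by (simp add: \<mu>_def)
  show ?thesis
  proof (cases "\<forall>i. Q \<le> real (k i)")
    \<comment> \<open>No small denominators occur, so every coordinate is independent up to the
      error 6 d / Q.\<close>
    case True
    have "(\<Prod>i\<in>UNIV. \<mu> i) \<le> (\<Prod>i\<in>(UNIV :: 'd set). E + 6 * d / Q)"
    proof (intro prod_mono conjI \<mu>)
      fix i
      have "6 * d / real (k i) \<le> 6 * d / Q"
        using True Q d k1[of i] by (intro divide_left_mono mult_pos_pos) auto
      then show "\<mu> i \<le> E + 6 * d / Q"
        using hk(4)[of i] by linarith
    qed
    also have "\<dots> = (E + 6 * d / Q) ^ CARD('d)"
      by simp
    also have "\<dots> \<le> (E + 6 * d / Q) ^ CARD('d)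
      + (Q * E + 6 * d) ^ CARD('d) * (\<Sum>i\<in>UNIV. resonance_weight T Q (D i) (D' i))"
      using E Q d by (simp add: sum_nonneg resonance_weight_nonneg)
    finally show ?thesis
      by (simp add: \<mu>_def)
  next
    case False
    then obtain i0 where i0: "real (k i0) < Q"
      by (auto simp: not_le)
    define m where "m = Min (range k)"
    have "m \<in> range k"
      unfolding m_def by (rule Min_in) auto
    then obtain i where i: "k i = m"
      by blast
    have mle: "m \<le> k j" for j
      by (simp add: m_def)
    have m1: "1 \<le> real m"
      using k1[of i] i by simp
    have mQ: "real m \<le> Q"
      using mle[of i0] i0 by linarith
    \<comment> \<open>Since m \<le> Q, also E \<le> Q E / m: the independent part is enlarged so
      that every factor carries 1 / m.\<close>
    have "(\<Prod>i\<in>UNIV. \<mu> i) \<le> (\<Prod>i\<in>(UNIV :: 'd set). (Q * E + 6 * d) / real m)"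
    proof (intro prod_mono conjI \<mu>)
      fix j
      have "6 * d / real (k j) \<le> 6 * d / real m"
        using mle[of j] d m1 by (intro divide_left_mono mult_pos_pos) auto
      moreover have "E * real m \<le> E * Q"
        using mQ E by (intro mult_left_mono)
      then have "E \<le> Q * E / real m"
        using m1 by (simp add: le_divide_eq mult.commute)
      ultimately show "\<mu> j \<le> (Q * E + 6 * d) / real m"
        using hk(4)[of j] by (simp add: add_divide_distrib)
    qed
    also have "\<dots> = (Q * E + 6 * d) ^ CARD('d) * (1 / real m ^ CARD('d))"
      by (simp add: power_divide)
    \<comment> \<open>Two of the factors 1 / m are kept, which is possible because the dimension is
      at least 2.\<close>
    also have "\<dots> \<le> (Q * E + 6 * d) ^ CARD('d) * (1 / (real m)\<^sup>2)"
      using m1 E Q d card by (intro mult_left_mono divide_left_mono power_increasing) auto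
    also have "\<dots> \<le> (Q * E + 6 * d) ^ CARD('d) * (\<Sum>i\<in>UNIV. resonance_weight T Q (D i) (D' i))"
    proof (intro mult_left_mono)
      have "1 / (real m)\<^sup>2 \<le> resonance_weight T Q (D i) (D' i)"
        using resonance_weight_ge[OF hk(1)[of i] hk(2)[of i] _ hk(3)[of i], of Q] i mQ by simp
      also have "\<dots> \<le> (\<Sum>i\<in>UNIV. resonance_weight T Q (D i) (D' i))"
        by (intro member_le_sum) (auto simp: resonance_weight_nonneg)
      finally show "1 / (real m)\<^sup>2 \<le> (\<Sum>i\<in>UNIV. resonance_weight T Q (D i) (D' i))" .
    qed (use E Q d in auto)
    also have "\<dots> \<le> (E + 6 * d / Q) ^ CARD('d)
      + (Q * E + 6 * d) ^ CARD('d) * (\<Sum>i\<in>UNIV. resonance_weight T Q (D i) (D' i))"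
      using E Q d by simp
    finally show ?thesis
      by (simp add: \<mu>_def)
  qed
qed

text \<open>Each (h, k) contributes at most three times the undilated count, in either order of the
  gaps. The k values of h leave k / k^2 = 1 / k, hence the harmonic sum.\<close>

lemma sum_resonance_weight_le:
  fixes D :: "'a \<Rightarrow> real" and T Q :: real
  assumes fin: "finite B" and T: "0 < T"
  shows "(\<Sum>w\<in>B. \<Sum>w'\<in>B. resonance_weight T Q (D w) (D w'))
    \<le> 6 * harm (nat \<lfloor>Q\<rfloor>) * real (card {(w, w') \<in> B \<times> B. \<bar>D w - D w'\<bar> \<le> T})"
proof -
  define e where "e = real (card {(w, w') \<in> B \<times> B. \<bar>D w - D w'\<bar> \<le> T})"
  have cnt: "(\<Sum>w\<in>B. \<Sum>w'\<in>B. of_bool (R w w') :: real) = real (card {(w, w') \<in> B \<times> B. R w w'})" for R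
  proof -
    have "(\<Sum>w\<in>B. \<Sum>w'\<in>B. of_bool (R w w') :: real) = (\<Sum>z\<in>B \<times> B. of_bool (R (fst z) (snd z)))"
      by (simp add: sum.cartesian_product case_prod_unfold)
    also have "\<dots> = real (card ({z \<in> B \<times> B. R (fst z) (snd z)}))"
      using fin by (simp add: of_bool_def sum.If_cases Int_def)
    also have "{z \<in> B \<times> B. R (fst z) (snd z)} = {(w, w') \<in> B \<times> B. R w w'}"
      by auto
    finally show ?thesis .
  qed
  have le: "(\<Sum>w\<in>B. \<Sum>w'\<in>B. of_bool (\<bar>real k * D w - real h * D w'\<bar> \<le> T) :: real) \<le> 3 * e"
    if "1 \<le> k" "1 \<le> h" for h k :: nat
    unfolding cnt e_def
    using card_dilated_near_le[OF fin T, of "real k" "real h" D] that by linarith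
  have swap: "(\<Sum>w\<in>B. \<Sum>w'\<in>B. of_bool (\<bar>real k * D w' - real h * D w\<bar> \<le> T) :: real) \<le> 3 * e"
    if "1 \<le> k" "1 \<le> h" for h k :: nat
    by (subst sum.swap) (rule le[OF that])
  have "(\<Sum>w\<in>B. \<Sum>w'\<in>B. resonance_weight T Q (D w) (D w'))
    = (\<Sum>k = 1..nat \<lfloor>Q\<rfloor>. \<Sum>h = 1..k. 1 / (real k)\<^sup>2 *
        ((\<Sum>w\<in>B. \<Sum>w'\<in>B. of_bool (\<bar>real k * D w' - real h * D w\<bar> \<le> T))
        + (\<Sum>w\<in>B. \<Sum>w'\<in>B. of_bool (\<bar>real k * D w - real h * D w'\<bar> \<le> T))))"
  proof -
    have "(\<Sum>w\<in>B. \<Sum>w'\<in>B. resonance_weight T Q (D w) (D w'))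
      = (\<Sum>w\<in>B. \<Sum>k = 1..nat \<lfloor>Q\<rfloor>. \<Sum>w'\<in>B. \<Sum>h = 1..k. 1 / (real k)\<^sup>2 *
         (of_bool (\<bar>real k * D w' - real h * D w\<bar> \<le> T) + of_bool (\<bar>real k * D w - real h * D w'\<bar> \<le> T)))"
      unfolding resonance_weight_def by (intro sum.cong refl sum.swap)
    also have "\<dots> = (\<Sum>w\<in>B. \<Sum>k = 1..nat \<lfloor>Q\<rfloor>. \<Sum>h = 1..k. \<Sum>w'\<in>B. 1 / (real k)\<^sup>2 *
         (of_bool (\<bar>real k * D w' - real h * D w\<bar> \<le> T) + of_bool (\<bar>real k * D w - real h * D w'\<bar> \<le> T)))"
      by (intro sum.cong refl sum.swap)
    also have "\<dots> = (\<Sum>k = 1..nat \<lfloor>Q\<rfloor>. \<Sum>w\<in>B. \<Sum>h = 1..k. \<Sum>w'\<in>B. 1 / (real k)\<^sup>2 *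
         (of_bool (\<bar>real k * D w' - real h * D w\<bar> \<le> T) + of_bool (\<bar>real k * D w - real h * D w'\<bar> \<le> T)))"
      by (rule sum.swap)
    also have "\<dots> = (\<Sum>k = 1..nat \<lfloor>Q\<rfloor>. \<Sum>h = 1..k. \<Sum>w\<in>B. \<Sum>w'\<in>B. 1 / (real k)\<^sup>2 *
         (of_bool (\<bar>real k * D w' - real h * D w\<bar> \<le> T) + of_bool (\<bar>real k * D w - real h * D w'\<bar> \<le> T)))"
      by (intro sum.cong refl sum.swap)
    finally show ?thesis
      by (simp only: sum_distrib_left sum.distrib distrib_left)
  qed
  also have "\<dots> \<le> (\<Sum>k = 1..nat \<lfloor>Q\<rfloor>. \<Sum>h = 1..k. 1 / (real k)\<^sup>2 * (3 * e + 3 * e))"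
    by (intro sum_mono mult_left_mono add_mono le swap) auto
  also have "\<dots> = (\<Sum>k = 1..nat \<lfloor>Q\<rfloor>. 6 * e * inverse (real k))"
    by (intro sum.cong refl) (auto simp: power2_eq_square field_simps)
  also have "\<dots> = 6 * harm (nat \<lfloor>Q\<rfloor>) * e"
    by (simp add: harm_def sum_distrib_left mult_ac)
  finally show ?thesis
    by (simp add: e_def)
qed

section \<open>Variance over a unit cube\<close>

definition unit_cube :: "real ^ 'd \<Rightarrow> (real ^ 'd) set" where
  "unit_cube c = {\<alpha>. \<forall>i. \<alpha> $ i \<in> {c $ i..c $ i + 1}}"

definition cube_space :: "real ^ 'd \<Rightarrow> (real ^ 'd) measure" where
  "cube_space c = restrict_space lborel (unit_cube c)"

definition hit_set :: "real ^ 'd \<Rightarrow> real ^ 'd \<Rightarrow> real \<Rightarrow> nat \<times> nat \<Rightarrow> (real ^ 'd) set" where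
  "hit_set c \<theta> d w = {\<alpha>. \<forall>i. \<alpha> $ i \<in> near_int_set (c $ i) d (powr_gap (\<theta> $ i) w)}"

lemma sets_unit_cube [measurable]: "unit_cube c \<in> sets borel"
  unfolding unit_cube_def by measurable

lemma space_cube_space: "space (cube_space c) = unit_cube c"
  by (simp add: cube_space_def space_restrict_space)

lemma prob_space_cube_space: "prob_space (cube_space c)"
proof (rule prob_spaceI)
  have "emeasure lborel (unit_cube c) = 1"
    unfolding unit_cube_def by (subst emeasure_vec_box) auto
  then show "emeasure (cube_space c) (space (cube_space c)) = 1"
    by (simp add: cube_space_def emeasure_restrict_space space_restrict_space)
qed

lemma hit_set_subset: "hit_set c \<theta> d w \<subseteq> unit_cube c"
  by (auto simp: hit_set_def unit_cube_def near_int_set_def)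

lemma sets_hit_set [measurable]: "hit_set c \<theta> d w \<in> sets (cube_space c)"
proof -
  have "hit_set c \<theta> d w \<in> sets borel"
    unfolding hit_set_def by measurable
  then show ?thesis
    using hit_set_subset[of c \<theta> d w] by (simp add: cube_space_def sets_restrict_space_iff)
qed

lemma measure_cube_space:
  "A \<subseteq> unit_cube c \<Longrightarrow> measure (cube_space c) A = measure lborel A"
  by (simp add: cube_space_def measure_restrict_space)

lemma measure_hit_set:
  "measure (cube_space c) (hit_set c \<theta> d w)
    = (\<Prod>i\<in>UNIV. measure lborel (near_int_set (c $ i) d (powr_gap (\<theta> $ i) w)))"
  unfolding measure_cube_space[OF hit_set_subset] unfolding hit_set_def
  by (rule measure_vec_box[OF fmeasurable_near_int_set])

lemma measure_hit_set_Int: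
  "measure (cube_space c) (hit_set c \<theta> d w \<inter> hit_set c \<theta> d w')
    = (\<Prod>i\<in>UNIV. measure lborel (near_int_set (c $ i) d (powr_gap (\<theta> $ i) w)
        \<inter> near_int_set (c $ i) d (powr_gap (\<theta> $ i) w')))"
proof -
  have "hit_set c \<theta> d w \<inter> hit_set c \<theta> d w' \<subseteq> unit_cube c"
    using hit_set_subset by blast
  moreover have "hit_set c \<theta> d w \<inter> hit_set c \<theta> d w' = {\<alpha>. \<forall>i. \<alpha> $ i \<in>
      near_int_set (c $ i) d (powr_gap (\<theta> $ i) w) \<inter> near_int_set (c $ i) d (powr_gap (\<theta> $ i) w')}"
    by (auto simp: hit_set_def)
  ultimately show ?thesis
    unfolding measure_cube_space
    by (simp only: measure_cube_space) (intro measure_vec_box fmeasurable.Int fmeasurable_near_int_set)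
qed

text \<open>A crude bound for the pairs outside \<open>large_pairs\<close>, whose gaps are only
  known to be at least 1.\<close>

lemma measure_hit_set_le:
  fixes \<theta> :: "real ^ 'd"
  assumes "\<And>i. 1 \<le> powr_gap (\<theta> $ i) w" "0 \<le> d" "2 * d \<le> 1"
  shows "measure (cube_space c) (hit_set c \<theta> d w) \<le> (6 * d) ^ CARD('d)"
proof -
  have "measure (cube_space c) (hit_set c \<theta> d w) \<le> (\<Prod>i\<in>(UNIV :: 'd set). 6 * d)"
    unfolding measure_hit_set by (intro prod_mono conjI measure_near_int_set_le assms) auto
  then show ?thesis by simp
qed

lemma measure_hit_set_ge:
  fixes \<theta> :: "real ^ 'd"
  assumes D: "\<And>i. Dmin \<le> powr_gap (\<theta> $ i) w" "2 \<le> Dmin" and d: "0 \<le> d" "2 * d < 1"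
  shows "(2 * d) ^ CARD('d) * (1 - 2 * real CARD('d) / Dmin) \<le> measure (cube_space c) (hit_set c \<theta> d w)"
proof -
  have "(2 * d) ^ CARD('d) * (1 - 2 * real CARD('d) / Dmin) \<le> (2 * d) ^ CARD('d) * (1 - 2 / Dmin) ^ CARD('d)"
    using Bernoulli_inequality[of "- 2 / Dmin" "CARD('d)"] D d
    by (intro mult_left_mono) (auto simp: field_simps)
  also have "\<dots> = (\<Prod>i\<in>(UNIV :: 'd set). 2 * d * (1 - 2 / Dmin))"
    by (simp add: power_mult_distrib)
  also have "\<dots> \<le> measure (cube_space c) (hit_set c \<theta> d w)"
    unfolding measure_hit_set
  proof (intro prod_mono conjI)
    fix i
    show "0 \<le> 2 * d * (1 - 2 / Dmin)"
      using D d by simp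
    have "2 * d * (1 - 2 / Dmin) \<le> 2 * d * (1 - 2 / powr_gap (\<theta> $ i) w)"
      using D(1)[of i] D(2) d by (intro mult_left_mono diff_left_mono divide_left_mono mult_pos_pos) auto
    also have "\<dots> \<le> measure lborel (near_int_set (c $ i) d (powr_gap (\<theta> $ i) w))"
      using D(1)[of i] D(2) d by (intro measure_near_int_set_ge) auto
    finally show "2 * d * (1 - 2 / Dmin) \<le> measure lborel (near_int_set (c $ i) d (powr_gap (\<theta> $ i) w))" .
  qed
  finally show ?thesis .
qed

text \<open>The deviation is taken from |B| p, the value under exact equidistribution, instead of
  the mean. After expanding the square, joint measures are needed from above and single measures
  from below. The relative deficit 2 d / Dmin of the latter (d the dimension) is doubled by the
  cross term and becomes the last term of the first bracket.\<close>

lemma integral_hit_count_deviation_le: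
  fixes \<theta> c :: "real ^ 'd" and d T Dmin Q e :: real and B :: "(nat \<times> nat) set"
  assumes card: "2 \<le> CARD('d)" and fin: "finite B"
    and T: "1 \<le> T" "T < Dmin" "2 \<le> Dmin" and D: "\<And>w i. w \<in> B \<Longrightarrow> Dmin \<le> powr_gap (\<theta> $ i) w"
    and d: "0 \<le> d" "2 * d < 1" and Q: "0 < Q"
    and e: "\<And>i. real (card {(w, w') \<in> B \<times> B. \<bar>powr_gap (\<theta> $ i) w - powr_gap (\<theta> $ i) w'\<bar> \<le> T}) \<le> e"
  defines "E \<equiv> 4 * d\<^sup>2 * (1 + 1 / T) + (12 * d\<^sup>2 + 18 * d * T) / Dmin"
    and "p \<equiv> (2 * d) ^ CARD('d)"
  shows "(\<integral>\<alpha>. ((\<Sum>w\<in>B. indicator (hit_set c \<theta> d w) \<alpha>) - real (card B) * p)\<^sup>2 \<partial>cube_space c)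
    \<le> (real (card B))\<^sup>2 * ((E + 6 * d / Q) ^ CARD('d) - p\<^sup>2 + 4 * real CARD('d) / Dmin * p\<^sup>2)
      + (Q * E + 6 * d) ^ CARD('d) * (real CARD('d) * (6 * harm (nat \<lfloor>Q\<rfloor>) * e))"
proof -
  interpret prob_space "cube_space c"
    by (rule prob_space_cube_space)
  let ?V = "hit_set c \<theta> d"
  let ?b = "real (card B)"
  let ?A = "(E + 6 * d / Q) ^ CARD('d)" and ?R = "(Q * E + 6 * d) ^ CARD('d)"
  have E: "0 \<le> E"
    using T d by (simp add: E_def)
  have p: "0 \<le> p"
    using d by (simp add: p_def)
  have "(\<Sum>w\<in>B. \<Sum>w'\<in>B. prob (?V w \<inter> ?V w')) \<le> (\<Sum>w\<in>B. \<Sum>w'\<in>B. ?A +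
      ?R * (\<Sum>i\<in>UNIV. resonance_weight T Q (powr_gap (\<theta> $ i) w) (powr_gap (\<theta> $ i) w')))"
    unfolding measure_hit_set_Int E_def
    using card T D d Q by (intro sum_mono prod_measure_near_int_le) auto
  also have "\<dots> = ?b\<^sup>2 * ?A + ?R *
      (\<Sum>w\<in>B. \<Sum>w'\<in>B. \<Sum>i\<in>UNIV. resonance_weight T Q (powr_gap (\<theta> $ i) w) (powr_gap (\<theta> $ i) w'))"
    by (simp add: sum.distrib power2_eq_square sum_distrib_left mult_ac)
  also have "(\<Sum>w\<in>B. \<Sum>w'\<in>B. \<Sum>i\<in>UNIV. resonance_weight T Q (powr_gap (\<theta> $ i) w) (powr_gap (\<theta> $ i) w'))
    = (\<Sum>i\<in>UNIV. \<Sum>w\<in>B. \<Sum>w'\<in>B. resonance_weight T Q (powr_gap (\<theta> $ i) w) (powr_gap (\<theta> $ i) w'))"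
  proof -
    have "(\<Sum>w\<in>B. \<Sum>w'\<in>B. \<Sum>i\<in>UNIV. resonance_weight T Q (powr_gap (\<theta> $ i) w) (powr_gap (\<theta> $ i) w'))
      = (\<Sum>w\<in>B. \<Sum>i\<in>UNIV. \<Sum>w'\<in>B. resonance_weight T Q (powr_gap (\<theta> $ i) w) (powr_gap (\<theta> $ i) w'))"
      by (intro sum.cong refl sum.swap)
    also have "\<dots> = (\<Sum>i\<in>UNIV. \<Sum>w\<in>B. \<Sum>w'\<in>B. resonance_weight T Q (powr_gap (\<theta> $ i) w) (powr_gap (\<theta> $ i) w'))"
      by (rule sum.swap)
    finally show ?thesis .
  qed
  also have "?b\<^sup>2 * ?A + ?R * \<dots> \<le> ?b\<^sup>2 * ?A + ?R * (\<Sum>i\<in>(UNIV :: 'd set). 6 * harm (nat \<lfloor>Q\<rfloor>) * e)"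
  proof (intro add_left_mono mult_left_mono sum_mono)
    fix i
    have "(\<Sum>w\<in>B. \<Sum>w'\<in>B. resonance_weight T Q (powr_gap (\<theta> $ i) w) (powr_gap (\<theta> $ i) w'))
      \<le> 6 * harm (nat \<lfloor>Q\<rfloor>) * real (card {(w, w') \<in> B \<times> B. \<bar>powr_gap (\<theta> $ i) w - powr_gap (\<theta> $ i) w'\<bar> \<le> T})"
      using fin T by (intro sum_resonance_weight_le) auto
    also have "\<dots> \<le> 6 * harm (nat \<lfloor>Q\<rfloor>) * e"
      using e by (intro mult_left_mono) (auto simp: harm_nonneg)
    finally show "(\<Sum>w\<in>B. \<Sum>w'\<in>B. resonance_weight T Q (powr_gap (\<theta> $ i) w) (powr_gap (\<theta> $ i) w'))
      \<le> 6 * harm (nat \<lfloor>Q\<rfloor>) * e" .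
  qed (use E Q d in auto)
  finally have pairs: "(\<Sum>w\<in>B. \<Sum>w'\<in>B. prob (?V w \<inter> ?V w'))
    \<le> ?b\<^sup>2 * ?A + ?R * (real CARD('d) * (6 * harm (nat \<lfloor>Q\<rfloor>) * e))"
    by simp
  have "(\<Sum>w\<in>B. p * (1 - 2 * real CARD('d) / Dmin)) \<le> (\<Sum>w\<in>B. prob (?V w))"
    unfolding p_def using T D d by (intro sum_mono measure_hit_set_ge) auto
  then have "2 * (?b * p) * (?b * (p * (1 - 2 * real CARD('d) / Dmin))) \<le> 2 * (?b * p) * (\<Sum>w\<in>B. prob (?V w))"
    using p by (intro mult_left_mono) auto
  moreover have "(\<integral>\<alpha>. ((\<Sum>w\<in>B. indicator (?V w) \<alpha>) - ?b * p)\<^sup>2 \<partial>cube_space c)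
      = (\<Sum>w\<in>B. \<Sum>w'\<in>B. prob (?V w \<inter> ?V w')) - 2 * (?b * p) * (\<Sum>w\<in>B. prob (?V w)) + (?b * p)\<^sup>2"
    by (rule integral_square_sum_indicator(2)[OF fin]) (rule sets_hit_set)
  moreover have "?b\<^sup>2 * (?A - p\<^sup>2 + 4 * real CARD('d) / Dmin * p\<^sup>2)
      = ?b\<^sup>2 * ?A - 2 * (?b * p) * (?b * (p * (1 - 2 * real CARD('d) / Dmin))) + (?b * p)\<^sup>2"
    by (simp add: algebra_simps power2_eq_square)
  ultimately show ?thesis
    using pairs by linarith
qed

lemma powr_gap_ge:
  assumes "2 \<le> p" "w \<in> large_pairs L N"
  shows "real (fst w) powr (p - 1) \<le> powr_gap p w"
  unfolding powr_gap_def using assms by (intro powr_diff_ge) (auto simp: large_pairs_def)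

text \<open>The chord bound for the convex function (1 + x)^n on [0, 1].\<close>

lemma power_one_plus_le:
  fixes x :: real
  assumes "0 \<le> x" "x \<le> 1"
  shows "(1 + x) ^ n \<le> 1 + (2 ^ n - 1) * x"
proof (induction n)
  case (Suc n)
  have "(1 + x) ^ Suc n \<le> (1 + x) * (1 + (2 ^ n - 1) * x)"
    using Suc assms by (simp add: mult_left_mono)
  also have "\<dots> = 1 + 2 ^ n * x + (2 ^ n - 1) * (x * x)"
    by (simp add: algebra_simps)
  also have "\<dots> \<le> 1 + 2 ^ n * x + (2 ^ n - 1) * (x * 1)"
    using assms by (intro add_left_mono mult_left_mono) auto
  finally show ?case
    by (simp add: algebra_simps)
qed simp

lemma harm_le_ln: "0 < n \<Longrightarrow> harm n \<le> 1 + ln (real n)"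
  using euler_mascheroni_sequence_decreasing[of 1 n] by (simp add: harm_expand)

text \<open>With n the dimension, T = N^\<tau> and Q = N^(\<tau> + 1 / n), the product of radius and
  Q is s T, so denominators beyond Q cost only a relative error O(N^(-\<tau>)). As p has order 1 /
  N, the nearly independent part is at most of order N^4 N^(-2) N^(-\<tau>). The resonant part is a
  product of (T d)^n, of order N^(n \<tau> - 1), a harmonic sum of at most N^\<tau>, and the energy
  N^(3 - \<kappa>). The choice (n + 1) \<tau> = \<kappa> / 2 makes it N^(2 - \<kappa> / 2).\<close>

lemma eventually_integral_deviation_le:
  fixes \<theta> c :: "real ^ 'd" and s \<kappa> \<tau> :: real
  assumes card: "2 \<le> CARD('d)" and s: "0 < s" and \<kappa>: "0 < \<kappa>" "\<kappa> \<le> 1 / 4"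
    and \<theta>: "\<And>i. 2 \<le> \<theta> $ i" "\<And>i. 4 * \<kappa> * \<theta> $ i \<le> \<theta> $ i - 2"
  defines "\<tau> \<equiv> \<kappa> / (2 * (real CARD('d) + 1))"
    and "B \<equiv> \<lambda>N. large_pairs (real N powr (1 - \<kappa>)) N"
    and "\<delta> \<equiv> \<lambda>N. s / real N powr (1 / real CARD('d))"
  shows "\<exists>C. \<forall>\<^sub>F N in sequentially.
    (\<integral>\<alpha>. ((\<Sum>w\<in>B N. indicator (hit_set c \<theta> (\<delta> N) w) \<alpha>)
        - real (card (B N)) * (2 * \<delta> N) ^ CARD('d))\<^sup>2 \<partial>cube_space c) \<le> C * real N powr (2 - \<tau>)"
proof -
  define n where "n = real CARD('d)"
  have n: "2 \<le> n"
    using card by (simp add: n_def)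
  have "\<kappa> / (2 * (n + 1)) \<le> \<kappa> / (2 * (2 + 1))"
    using n \<kappa> by (intro divide_left_mono) auto
  then have "\<tau> \<le> \<kappa> / 6"
    by (simp add: \<tau>_def n_def)
  moreover have "0 < \<tau>"
    using \<kappa> by (simp add: \<tau>_def)
  ultimately have \<tau>: "0 < \<tau>" "6 * \<tau> \<le> \<kappa>"
    by simp_all
  have n\<tau>: "n * \<tau> + \<tau> = \<kappa> / 2"
  proof -
    have "\<tau> = (\<kappa> / 2) / (n + 1)"
      by (simp add: \<tau>_def n_def)
    moreover have "n + 1 \<noteq> 0"
      using n by simp
    ultimately have "\<tau> * (n + 1) = \<kappa> / 2"
      using nonzero_eq_divide_eq by blast
    then show ?thesis
      by (simp add: distrib_left mult.commute)
  qed
  have n2: "1 / n \<le> 1 / 2"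
    using n by (simp add: field_simps)
  \<comment> \<open>The coefficients of the four parts of X below: 1 + 3 without s, and 9/2 + 3/2
    over s.\<close>
  define x1 where "x1 = 4 + 6 / s"
  define C1 where "C1 = (2 * s) ^ (2 * CARD('d)) * ((2 ^ CARD('d) - 1) * x1 + 4 * n)"
  define C2 where "C2 = ((8 * s + 6) * s) ^ CARD('d) * (n * 36)"
  have "\<forall>\<^sub>F N in sequentially. 2 * s * real N powr 0 < real N powr (1 / n)"
    by (rule eventually_powr_less) (use n in auto)
  moreover have "\<forall>\<^sub>F N in sequentially. 1 * real N powr \<tau> < real N powr (1 + \<kappa>)"
    by (rule eventually_powr_less) (use \<tau> \<kappa> in auto)
  moreover have "\<forall>\<^sub>F N in sequentially. 2 * real N powr 0 < real N powr (1 + \<kappa>)"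
    by (rule eventually_powr_less) (use \<kappa> in auto)
  moreover have "\<forall>\<^sub>F N in sequentially. x1 * real N powr (- \<tau>) < real N powr 0"
    by (rule eventually_powr_less) (use \<tau> in auto)
  moreover have "\<forall>\<^sub>F N in sequentially. 1 + 2 * ln (real N) \<le> real N powr \<tau>"
    using \<tau> by real_asymp
  moreover have "\<forall>\<^sub>F N in sequentially. \<forall>i\<in>UNIV.
    real (card {(w, w') \<in> B N \<times> B N. \<bar>powr_gap (\<theta> $ i) w - powr_gap (\<theta> $ i) w'\<bar> \<le> real N powr \<tau>})
      \<le> 6 * real N powr (3 - \<kappa>)"
    unfolding B_def using \<theta> \<kappa> \<tau> by (intro eventually_ball_finite ballI eventually_energy_le) auto
  moreover have "\<forall>\<^sub>F N in sequentially. 0 < N"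
    by (rule eventually_gt_at_top)
  ultimately have "\<forall>\<^sub>F N in sequentially.
    (\<integral>\<alpha>. ((\<Sum>w\<in>B N. indicator (hit_set c \<theta> (\<delta> N) w) \<alpha>)
        - real (card (B N)) * (2 * \<delta> N) ^ CARD('d))\<^sup>2 \<partial>cube_space c) \<le> (C1 + C2) * real N powr (2 - \<tau>)"
  proof eventually_elim
    case (elim N)
    define d where "d = \<delta> N"
    define T where "T = real N powr \<tau>"
    define Dmin where "Dmin = real N powr (1 + \<kappa>)"
    define Q where "Q = real N powr (\<tau> + 1 / n)"
    define E where "E = 4 * d\<^sup>2 * (1 + 1 / T) + (12 * d\<^sup>2 + 18 * d * T) / Dmin"
    define p where "p = (2 * d) ^ CARD('d)"
    \<comment> \<open>The relative error of the one-coordinate bound against the independent value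
      (2 d)^2.\<close>
    define X where "X = (E + 6 * d / Q) / (4 * d\<^sup>2) - 1"
    have N: "1 \<le> real N"
      using elim by simp
    have mono: "real N powr a \<le> real N powr b" if "a \<le> b" for a b
      using N that by (intro powr_mono)
    have d_eq: "d = s * real N powr (- 1 / n)"
      by (simp add: d_def \<delta>_def n_def powr_minus divide_inverse)
    have d: "0 < d" "2 * d < 1"
      using s N elim by (simp_all add: d_def \<delta>_def divide_less_eq flip: n_def)
    have dn: "d ^ CARD('d) = s ^ CARD('d) / real N"
    proof -
      have "(real N powr (1 / n)) ^ CARD('d) = real N"
        using N n by (simp add: powr_power n_def)
      then show ?thesis
        by (simp add: d_def \<delta>_def power_divide flip: n_def)
    qed
    have T: "1 \<le> T" "0 < Q" "0 < Dmin"
      using N \<tau> by (auto simp: T_def Q_def Dmin_def ge_one_powr_ge_zero)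
    have Xeq: "X = 1 / T + 3 * (1 / Dmin) + 9 / 2 * (T / (d * Dmin)) + 3 / 2 * (1 / (d * Q))"
      using d T by (simp add: X_def E_def field_simps power2_eq_square)
    have T': "1 / T = real N powr (- \<tau>)"
      by (simp add: T_def powr_minus divide_inverse)
    have Dm: "1 / Dmin \<le> real N powr (- \<tau>)"
    proof -
      have "1 / Dmin = real N powr (- (1 + \<kappa>))"
        unfolding Dmin_def by (subst powr_minus) (simp add: divide_inverse)
      also have "\<dots> \<le> real N powr (- \<tau>)"
        using \<tau> \<kappa> by (intro mono) auto
      finally show ?thesis .
    qed
    have TdD: "T / (d * Dmin) \<le> real N powr (- \<tau>) / s"
    proof -
      have "T / (d * Dmin) = real N powr (\<tau> + 1 / n - (1 + \<kappa>)) / s"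
        using N by (simp add: T_def d_eq Dmin_def powr_diff powr_add powr_minus field_simps)
      also have "\<dots> \<le> real N powr (- \<tau>) / s"
        using \<tau> \<kappa> n2 s by (intro divide_right_mono mono) auto
      finally show ?thesis .
    qed
    have dQ: "d * Q = s * T"
      using N by (simp add: d_eq Q_def T_def powr_add powr_minus field_simps)
    have X: "X \<le> x1 * real N powr (- \<tau>)"
    proof -
      have "1 / (d * Q) = real N powr (- \<tau>) / s"
        unfolding dQ T'[symmetric] by (simp add: mult.commute)
      then have "X \<le> real N powr (- \<tau>) + 3 * real N powr (- \<tau>) + 9 / 2 * (real N powr (- \<tau>) / s)
          + 3 / 2 * (real N powr (- \<tau>) / s)"
        unfolding Xeq T' using Dm TdD by (intro add_mono mult_left_mono) simp_all
      also have "\<dots> = x1 * real N powr (- \<tau>)"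
        by (simp add: x1_def field_simps)
      finally show ?thesis .
    qed
    have X01: "0 \<le> X" "X \<le> 1"
    proof -
      show "0 \<le> X"
        unfolding Xeq using d T by (intro add_nonneg_nonneg) auto
      show "X \<le> 1"
        using X elim N by simp
    qed
    have EX: "E + 6 * d / Q = 4 * d\<^sup>2 * (1 + X)"
      using d by (simp add: X_def)
    have p2: "(4 * d\<^sup>2) ^ CARD('d) = p\<^sup>2"
    proof -
      have "4 * d\<^sup>2 = (2 * d)\<^sup>2"
        by (simp add: power_mult_distrib)
      then show ?thesis
        unfolding p_def by (metis power_mult mult.commute)
    qed
    have p2': "p\<^sup>2 = (2 * s) ^ (2 * CARD('d)) / (real N)\<^sup>2"
    proof -
      have "p = (2 * s) ^ CARD('d) / real N"
        by (simp add: p_def power_mult_distrib dn)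
      then show ?thesis
        by (metis power_divide power_mult mult.commute)
    qed
    have first: "(real (card (B N)))\<^sup>2 * ((E + 6 * d / Q) ^ CARD('d) - p\<^sup>2 + 4 * n / Dmin * p\<^sup>2)
      \<le> C1 * real N powr (2 - \<tau>)"
    proof -
      have "(E + 6 * d / Q) ^ CARD('d) \<le> p\<^sup>2 * (1 + (2 ^ CARD('d) - 1) * X)"
        unfolding EX power_mult_distrib[of "4 * d\<^sup>2"] p2
        by (intro mult_left_mono power_one_plus_le X01) auto
      moreover have "p\<^sup>2 * ((2 ^ CARD('d) - 1) * X) \<le> p\<^sup>2 * ((2 ^ CARD('d) - 1) * (x1 * real N powr (- \<tau>)))"
        using X by (intro mult_left_mono) auto
      moreover have "4 * n / Dmin * p\<^sup>2 \<le> 4 * n * real N powr (- \<tau>) * p\<^sup>2"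
        using mult_left_mono[OF Dm, of "4 * n"] n by (intro mult_right_mono) auto
      ultimately have "(E + 6 * d / Q) ^ CARD('d) - p\<^sup>2 + 4 * n / Dmin * p\<^sup>2
        \<le> p\<^sup>2 * (((2 ^ CARD('d) - 1) * x1 + 4 * n) * real N powr (- \<tau>))"
        by (simp add: algebra_simps)
      also have "\<dots> = C1 * real N powr (- \<tau>) / (real N)\<^sup>2"
        by (simp add: p2' C1_def)
      finally have le: "(E + 6 * d / Q) ^ CARD('d) - p\<^sup>2 + 4 * n / Dmin * p\<^sup>2
        \<le> C1 * real N powr (- \<tau>) / (real N)\<^sup>2" .
      have C1: "0 \<le> C1"
        using s n by (auto simp: C1_def x1_def intro!: mult_nonneg_nonneg add_nonneg_nonneg)
      have "(real (card (B N)))\<^sup>2 * ((E + 6 * d / Q) ^ CARD('d) - p\<^sup>2 + 4 * n / Dmin * p\<^sup>2)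
        \<le> (real (card (B N)))\<^sup>2 * (C1 * real N powr (- \<tau>) / (real N)\<^sup>2)"
        by (intro mult_left_mono le) auto
      also have "\<dots> \<le> ((real N)\<^sup>2)\<^sup>2 * (C1 * real N powr (- \<tau>) / (real N)\<^sup>2)"
      proof (intro mult_right_mono power_mono)
        show "real (card (B N)) \<le> (real N)\<^sup>2"
          using card_large_pairs_le[of "real N powr (1 - \<kappa>)" N] unfolding B_def
          by (metis of_nat_le_iff of_nat_power)
      qed (use C1 in auto)
      also have "\<dots> = C1 * real N powr (2 - \<tau>)"
        using N by (simp add: powr_diff powr_minus powr_numeral power2_eq_square field_simps)
      finally show ?thesis .
    qed
    have second: "(Q * E + 6 * d) ^ CARD('d) * (n * (6 * harm (nat \<lfloor>Q\<rfloor>) * (6 * real N powr (3 - \<kappa>))))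
      \<le> C2 * real N powr (2 - \<tau>)"
    proof -
      have E: "0 \<le> E"
        using T d by (simp add: E_def)
      have "E \<le> E + 6 * d / Q"
        using d T by simp
      also have "\<dots> \<le> 4 * d\<^sup>2 * 2"
        unfolding EX using X01 by (intro mult_left_mono) auto
      finally have "Q * E \<le> Q * (8 * d\<^sup>2)"
        using T by (intro mult_left_mono) auto
      also have "\<dots> = (8 * s * T) * d"
        using dQ by (simp add: power2_eq_square mult_ac)
      finally have QE: "Q * E \<le> (8 * s * T) * d" .
      have "1 * (6 * d) \<le> T * (6 * d)"
        using T d by (intro mult_right_mono) auto
      with QE have "Q * E + 6 * d \<le> (8 * s + 6) * T * d"
        by (simp add: algebra_simps)
      then have "(Q * E + 6 * d) ^ CARD('d) \<le> ((8 * s + 6) * T * d) ^ CARD('d)"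
        using T E d by (intro power_mono) auto
      also have "\<dots> = ((8 * s + 6) * s) ^ CARD('d) * real N powr (n * \<tau> - 1)"
      proof -
        have "T ^ CARD('d) = real N powr (n * \<tau>)"
          using N by (simp add: T_def powr_power n_def mult.commute)
        then show ?thesis
          using N by (simp add: power_mult_distrib dn powr_diff)
      qed
      finally have 1: "(Q * E + 6 * d) ^ CARD('d) \<le> ((8 * s + 6) * s) ^ CARD('d) * real N powr (n * \<tau> - 1)" .
      have 2: "harm (nat \<lfloor>Q\<rfloor>) \<le> real N powr \<tau>"
      proof -
        have Q1: "1 \<le> Q"
          unfolding Q_def using N \<tau> n by (intro ge_one_powr_ge_zero) auto
        then have "0 < nat \<lfloor>Q\<rfloor>"
          by simp
        then have "harm (nat \<lfloor>Q\<rfloor>) \<le> 1 + ln (real (nat \<lfloor>Q\<rfloor>))"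
          by (rule harm_le_ln)
        also have "\<dots> \<le> 1 + ln Q"
          using Q1 by (intro add_left_mono ln_mono) auto
        also have "ln Q = (\<tau> + 1 / n) * ln (real N)"
          using N by (simp add: Q_def ln_powr)
        also have "\<dots> \<le> 2 * ln (real N)"
          using N \<tau> \<kappa> n2 by (intro mult_right_mono) auto
        finally show ?thesis
          using elim by simp
      qed
      have "(Q * E + 6 * d) ^ CARD('d) * (n * (6 * harm (nat \<lfloor>Q\<rfloor>) * (6 * real N powr (3 - \<kappa>))))
        \<le> ((8 * s + 6) * s) ^ CARD('d) * real N powr (n * \<tau> - 1) * (n * (6 * real N powr \<tau> * (6 * real N powr (3 - \<kappa>))))"
        using n s by (intro mult_mono mult_left_mono mult_right_mono 1 2) (auto simp: harm_nonneg)
      also have "\<dots> = C2 * real N powr ((n * \<tau> - 1) + \<tau> + (3 - \<kappa>))"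
        unfolding C2_def powr_add[of _ _ "3 - \<kappa>"] powr_add[of _ _ \<tau>] by simp
      also have "(n * \<tau> - 1) + \<tau> + (3 - \<kappa>) = 2 - \<kappa> / 2"
        using n\<tau> by linarith
      also have "C2 * real N powr (2 - \<kappa> / 2) \<le> C2 * real N powr (2 - \<tau>)"
        using \<tau> \<kappa> s n by (intro mult_left_mono mono) (auto simp: C2_def)
      finally show ?thesis .
    qed
    have "(\<integral>\<alpha>. ((\<Sum>w\<in>B N. indicator (hit_set c \<theta> d w) \<alpha>) - real (card (B N)) * p)\<^sup>2 \<partial>cube_space c)
      \<le> (real (card (B N)))\<^sup>2 * ((E + 6 * d / Q) ^ CARD('d) - p\<^sup>2 + 4 * n / Dmin * p\<^sup>2)
        + (Q * E + 6 * d) ^ CARD('d) * (n * (6 * harm (nat \<lfloor>Q\<rfloor>) * (6 * real N powr (3 - \<kappa>))))"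
      unfolding E_def p_def n_def
    proof (rule integral_hit_count_deviation_le[OF card])
      fix w i assume w: "w \<in> B N"
      \<comment> \<open>The slack is \<theta> - 2 - \<kappa> \<theta>, nonnegative by the choice of
        \<kappa>; this is why Dmin can be taken as N^(1 + \<kappa>).\<close>
      have "(1 - \<kappa>) * (\<theta> $ i - 1) \<ge> 1 + \<kappa>"
      proof -
        have "0 \<le> \<kappa> * \<theta> $ i"
          using \<kappa> \<theta>(1)[of i] by simp
        then have "0 \<le> \<theta> $ i - 1 - \<kappa> * \<theta> $ i + \<kappa> - (1 + \<kappa>)"
          using \<theta>(2)[of i] by linarith
        then show ?thesis
          by (simp add: algebra_simps)
      qed
      then have "Dmin \<le> real N powr ((1 - \<kappa>) * (\<theta> $ i - 1))"
        unfolding Dmin_def by (rule mono)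
      also have "\<dots> = (real N powr (1 - \<kappa>)) powr (\<theta> $ i - 1)"
        by (simp add: powr_powr)
      also have "\<dots> \<le> real (fst w) powr (\<theta> $ i - 1)"
        using w \<theta>(1)[of i] by (intro powr_mono2) (auto simp: B_def large_pairs_def)
      also have "\<dots> \<le> powr_gap (\<theta> $ i) w"
        using w \<theta>(1)[of i] by (intro powr_gap_ge) (auto simp: B_def)
      finally show "Dmin \<le> powr_gap (\<theta> $ i) w" .
    next
      show "T < Dmin" "2 \<le> Dmin"
        using elim N by (auto simp: T_def Dmin_def)
      show "real (card {(w, w') \<in> B N \<times> B N. \<bar>powr_gap (\<theta> $ i) w - powr_gap (\<theta> $ i) w'\<bar> \<le> T})
        \<le> 6 * real N powr (3 - \<kappa>)" for i
        using elim by (simp add: T_def)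
    qed (use T d in \<open>auto simp: B_def\<close>)
    with first second show ?case
      by (simp add: d_def p_def distrib_right)
  qed
  then show ?thesis
    by blast
qed

section \<open>Almost sure convergence\<close>

definition ordered_pairs :: "nat \<Rightarrow> (nat \<times> nat) set" where
  "ordered_pairs N = {(n, m). 1 \<le> m \<and> m < n \<and> n \<le> N}"

definition close_count :: "real ^ 'd \<Rightarrow> real ^ 'd \<Rightarrow> nat \<Rightarrow> real \<Rightarrow> nat" where
  "close_count \<theta> \<alpha> N d = card {w \<in> ordered_pairs N. \<forall>i. nint (powr_gap (\<theta> $ i) w * \<alpha> $ i) \<le> d}"

lemma finite_ordered_pairs [simp]: "finite (ordered_pairs N)"
  by (rule finite_subset[of _ "{1..N} \<times> {1..N}"]) (auto simp: ordered_pairs_def)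

lemma card_ordered_pairs: "real (card (ordered_pairs N)) = real N * (real N - 1) / 2"
proof -
  have "ordered_pairs N = (SIGMA n:{1..N}. {1..<n})"
    by (auto simp: ordered_pairs_def)
  then have "card (ordered_pairs N) = (\<Sum>n = 1..N. n - 1)"
    by simp
  moreover have "real (\<Sum>n = 1..N. n - 1) = real N * (real N - 1) / 2"
    by (induction N) (auto simp: field_simps)
  ultimately show ?thesis by simp
qed

lemma close_count_mono:
  assumes "M \<le> N" "d \<le> e"
  shows "close_count \<theta> \<alpha> M d \<le> close_count \<theta> \<alpha> N e"
  unfolding close_count_def
proof (intro card_mono subsetI)
  fix w assume w: "w \<in> {w \<in> ordered_pairs M. \<forall>i. nint (powr_gap (\<theta> $ i) w * \<alpha> $ i) \<le> d}"
  then have "nint (powr_gap (\<theta> $ i) w * \<alpha> $ i) \<le> e" for i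
    using assms(2) by (auto intro: order_trans)
  then show "w \<in> {w \<in> ordered_pairs N. \<forall>i. nint (powr_gap (\<theta> $ i) w * \<alpha> $ i) \<le> e}"
    using w assms(1) by (auto simp: ordered_pairs_def)
qed auto

text \<open>The sup-norm constrains the coordinates independently, so the integer shift may be
  optimised in each of them separately.\<close>

lemma infnorm_mod1_le_iff:
  fixes z :: "real ^ 'd"
  shows "infnorm_mod1 z \<le> d \<longleftrightarrow> (\<forall>i. nint (z $ i) \<le> d)"
proof
  assume "infnorm_mod1 z \<le> d"
  then obtain k :: "real ^ 'd" where k: "k \<in> integer_points" "infnorm (z + k) \<le> d"
    using infnorm_mod1_attained[of z] by metis
  show "\<forall>i. nint (z $ i) \<le> d"
  proof
    fix i
    obtain m :: int where "k $ i = of_int m"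
      using k(1) by (auto simp: integer_points_def elim: Ints_cases)
    moreover have "\<bar>(z + k) $ i\<bar> \<le> d"
      using k(2) infnorm_vec_le_iff by blast
    ultimately have "\<bar>z $ i - of_int (- m)\<bar> \<le> d"
      by simp
    then show "nint (z $ i) \<le> d"
      unfolding nint_le_iff by blast
  qed
next
  assume d: "\<forall>i. nint (z $ i) \<le> d"
  define k :: "real ^ 'd" where "k = (\<chi> i. - of_int (round (z $ i)))"
  have "k \<in> integer_points"
    by (simp add: k_def integer_points_def)
  then have "infnorm_mod1 z \<le> infnorm (z + k)"
    using infnorm_mod1_attained[of z] by auto
  also have "\<dots> \<le> d"
    unfolding infnorm_vec_le_iff using d by (simp add: k_def nint_def)
  finally show "infnorm_mod1 z \<le> d" .
qed

text \<open>Taking fractional parts alters differences by integers, and exchanging n and m alters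
  the sign; \<open>nint\<close> is invariant under both. The ordered pairs are therefore those with
  m < n, counted twice.\<close>

lemma pair_correlation_eq_close_count:
  fixes \<theta> \<alpha> :: "real ^ 'd"
  defines "y \<equiv> \<lambda>n. \<chi> i. frac ((\<chi> i. real n powr (\<theta> $ i)) $ i * \<alpha> $ i)"
  shows "pair_correlation s y N
    = 2 * real (close_count \<theta> \<alpha> N (s / real N powr (1 / real CARD('d)))) / real N"
proof -
  define d where "d = s / real N powr (1 / real CARD('d))"
  define C where "C = {w \<in> ordered_pairs N. \<forall>i. nint (powr_gap (\<theta> $ i) w * \<alpha> $ i) \<le> d}"
  have close: "infnorm_mod1 (y n - y m) \<le> d \<longleftrightarrow> (\<forall>i. nint (powr_gap (\<theta> $ i) (n, m) * \<alpha> $ i) \<le> d)" for n m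
    by (simp add: infnorm_mod1_le_iff y_def nint_frac_diff powr_gap_def left_diff_distrib)
  have sym: "nint (powr_gap p (n, m) * a) = nint (powr_gap p (m, n) * a)" for p n m a
  proof -
    have "powr_gap p (n, m) * a = - (powr_gap p (m, n) * a)"
      by (simp add: powr_gap_def algebra_simps)
    then show ?thesis
      by (simp only: nint_minus)
  qed
  have "{(n, m). n \<in> {1..N} \<and> m \<in> {1..N} \<and> n \<noteq> m \<and> infnorm_mod1 (y n - y m) \<le> d} = C \<union> prod.swap ` C"
  proof (intro equalityI subsetI)
    fix w assume "w \<in> {(n, m). n \<in> {1..N} \<and> m \<in> {1..N} \<and> n \<noteq> m \<and> infnorm_mod1 (y n - y m) \<le> d}"
    then obtain n m where w: "w = (n, m)" "n \<in> {1..N}" "m \<in> {1..N}" "n \<noteq> m"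
      "\<forall>i. nint (powr_gap (\<theta> $ i) (n, m) * \<alpha> $ i) \<le> d"
      using close by auto
    show "w \<in> C \<union> prod.swap ` C"
    proof (cases "m < n")
      case True
      then show ?thesis
        using w by (auto simp: C_def ordered_pairs_def)
    next
      case False
      then have "(m, n) \<in> C"
        using w sym by (auto simp: C_def ordered_pairs_def)
      then show ?thesis
        using w(1) by force
    qed
  next
    fix w assume "w \<in> C \<union> prod.swap ` C"
    then show "w \<in> {(n, m). n \<in> {1..N} \<and> m \<in> {1..N} \<and> n \<noteq> m \<and> infnorm_mod1 (y n - y m) \<le> d}"
      using close sym by (auto simp: C_def ordered_pairs_def)
  qed
  moreover have "card (C \<union> prod.swap ` C) = 2 * card C"
  proof -
    have "C \<inter> prod.swap ` C = {}"
      by (auto simp: C_def ordered_pairs_def)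
    moreover have "finite C"
      by (simp add: C_def)
    moreover have "card (prod.swap ` C) = card C"
      by (intro card_image) simp
    ultimately show ?thesis
      by (simp add: card_Un_disjoint)
  qed
  ultimately show ?thesis
    unfolding pair_correlation_def close_count_def by (simp add: C_def d_def)
qed

section \<open>From moments to almost sure limits\<close>

text \<open>At N = (k + 1)^q the bound N^(-\<eta>) is at most (k + 1)^(-2), so the integrals are
  summable. Hence the series of the nonnegative functions is finite almost everywhere and its terms
  tend to 0.\<close>

lemma AE_tendsto_zero_along_powers:
  fixes g :: "nat \<Rightarrow> 'a \<Rightarrow> real" and C \<eta> :: real and q :: nat
  assumes int: "\<And>N. integrable M (g N)" and nonneg: "\<And>N x. 0 \<le> g N x"
    and bound: "\<forall>\<^sub>F N in sequentially. (\<integral>x. g N x \<partial>M) \<le> C * real N powr (- \<eta>)"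
    and q: "2 \<le> real q * \<eta>" "1 \<le> q"
  shows "AE x in M. (\<lambda>k. g (Suc k ^ q) x) \<longlonglongrightarrow> 0"
proof -
  have lim: "filterlim (\<lambda>k. Suc k ^ q) at_top sequentially"
  proof (rule filterlim_at_top_mono[OF filterlim_Suc])
    show "\<forall>\<^sub>F k in sequentially. Suc k \<le> Suc k ^ q"
      using q(2) by (intro always_eventually allI) (simp add: self_le_power)
  qed
  have "\<forall>\<^sub>F k in sequentially. (\<integral>x. g (Suc k ^ q) x \<partial>M) \<le> C * real (Suc k ^ q) powr (- \<eta>)"
    using lim bound by (rule filterlim_iff[THEN iffD1, rule_format])
  then have ev: "\<forall>\<^sub>F k in sequentially. norm (\<integral>x. g (Suc k ^ q) x \<partial>M) \<le> \<bar>C\<bar> * (1 / real (Suc k) ^ 2)"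
  proof eventually_elim
    case (elim k)
    have "real (Suc k ^ q) powr (- \<eta>) = real (Suc k) powr (- (real q * \<eta>))"
      by (simp add: powr_powr flip: powr_realpow)
    also have "\<dots> \<le> real (Suc k) powr (- 2)"
      using q by (intro powr_mono) auto
    also have "\<dots> = 1 / real (Suc k) ^ 2"
      by (simp add: powr_minus powr_numeral divide_inverse)
    finally have "real (Suc k ^ q) powr (- \<eta>) \<le> 1 / real (Suc k) ^ 2" .
    then have "\<bar>C\<bar> * real (Suc k ^ q) powr (- \<eta>) \<le> \<bar>C\<bar> * (1 / real (Suc k) ^ 2)"
      by (intro mult_left_mono) auto
    moreover have "C * real (Suc k ^ q) powr (- \<eta>) \<le> \<bar>C\<bar> * real (Suc k ^ q) powr (- \<eta>)"
      by (intro mult_right_mono) auto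
    moreover have "0 \<le> (\<integral>x. g (Suc k ^ q) x \<partial>M)"
      by (intro Bochner_Integration.integral_nonneg nonneg)
    ultimately show ?case
      unfolding real_norm_def using elim by linarith
  qed
  have "summable (\<lambda>k. \<bar>C\<bar> * (1 / real (Suc k) ^ 2))"
    using inverse_squares_sums by (intro summable_mult) (simp add: sums_iff)
  then have summ: "summable (\<lambda>k. \<integral>x. g (Suc k ^ q) x \<partial>M)"
    using ev by (rule summable_comparison_test_ev[rotated])
  have "(\<integral>\<^sup>+x. (\<Sum>k. ennreal (g (Suc k ^ q) x)) \<partial>M) = (\<Sum>k. \<integral>\<^sup>+x. ennreal (g (Suc k ^ q) x) \<partial>M)"
    using int by (intro nn_integral_suminf) auto
  also have "\<dots> = (\<Sum>k. ennreal (\<integral>x. g (Suc k ^ q) x \<partial>M))"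
    using int nonneg by (intro suminf_cong nn_integral_eq_integral) auto
  also have "\<dots> \<noteq> \<infinity>"
    using summ nonneg by (simp add: suminf_ennreal2 Bochner_Integration.integral_nonneg)
  finally have "AE x in M. (\<Sum>k. ennreal (g (Suc k ^ q) x)) \<noteq> \<infinity>"
    using int by (intro nn_integral_PInf_AE borel_measurable_suminf) auto
  then show ?thesis
  proof eventually_elim
    case (elim x)
    then have "summable (\<lambda>k. g (Suc k ^ q) x)"
      using nonneg by (intro summable_suminf_not_top) auto
    then show ?case
      by (rule summable_LIMSEQ_zero)
  qed
qed

text \<open>For N between consecutive powers, the count is squeezed between the count at the lower
  power with a scale r1 < s and that at the upper power with a scale r2 > s. The quotient of
  consecutive powers tends to 1, so neither the change of radius nor that of the normalisation
  matters. Restricting the hypothesis to rational scales leaves only countably many exceptional null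
  sets in the application.\<close>

lemma tendsto_of_tendsto_along_powers:
  fixes f :: "nat \<Rightarrow> real \<Rightarrow> nat" and \<rho> s :: real and q n :: nat
  assumes mono: "\<And>M N d e. M \<le> N \<Longrightarrow> d \<le> e \<Longrightarrow> f M d \<le> f N e"
    and \<rho>: "0 < \<rho>" and q: "1 \<le> q" and s: "0 < s"
    and lim: "\<And>r. r \<in> \<rat> \<Longrightarrow> 0 < r \<Longrightarrow>
      (\<lambda>k. 2 * real (f (Suc k ^ q) (r / real (Suc k ^ q) powr \<rho>)) / real (Suc k ^ q)) \<longlonglongrightarrow> (2 * r) ^ n"
  shows "(\<lambda>N. 2 * real (f N (s / real N powr \<rho>)) / real N) \<longlonglongrightarrow> (2 * s) ^ n"
proof (rule LIMSEQ_I)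
  fix e :: real assume e: "0 < e"
  have "isCont (\<lambda>r. (2 * r) ^ n) s"
    by (intro continuous_intros)
  then obtain h where h: "0 < h" "\<And>r. \<bar>r - s\<bar> < h \<Longrightarrow> \<bar>(2 * r) ^ n - (2 * s) ^ n\<bar> < e"
    using e unfolding continuous_at_eps_delta dist_real_def by metis
  \<comment> \<open>The bound s / 2 keeps r1 positive.\<close>
  obtain r1 where r1: "r1 \<in> \<rat>" "max (s / 2) (s - h) < r1" "r1 < s"
    using Rats_dense_in_real[of "max (s / 2) (s - h)" s] s h(1) by auto
  obtain r2 where r2: "r2 \<in> \<rat>" "s < r2" "r2 < s + h"
    using Rats_dense_in_real[of s "s + h"] h(1) by auto
  have r: "0 < r1" "0 < r2" "(2 * s) ^ n - e < (2 * r1) ^ n" "(2 * r2) ^ n < (2 * s) ^ n + e"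
    using r1 r2 s h(2)[of r1] h(2)[of r2] by auto
  define a where "a k = real (Suc k ^ q)" for k
  define R where "R r k = 2 * real (f (Suc k ^ q) (r / a k powr \<rho>)) / a k" for r k
  have apos: "0 < a k" for k
    by (simp add: a_def)
  have ratio: "(\<lambda>k. a (Suc k) / a k) \<longlonglongrightarrow> 1"
  proof -
    have "(\<lambda>k. (real (Suc (Suc k)) / real (Suc k)) ^ q) \<longlonglongrightarrow> 1 ^ q"
      by (intro tendsto_power) real_asymp
    then show ?thesis
      by (simp add: a_def power_divide)
  qed
  have ratio': "(\<lambda>k. a k / a (Suc k)) \<longlonglongrightarrow> 1"
    using tendsto_inverse[OF ratio] by (simp add: inverse_eq_divide)
  have "(\<lambda>k. a (Suc k) / a k * R r2 (Suc k)) \<longlonglongrightarrow> 1 * (2 * r2) ^ n"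
    using LIMSEQ_Suc[OF lim[OF r2(1) r(2)]] by (intro tendsto_mult ratio) (simp add: R_def a_def)
  then have "\<forall>\<^sub>F k in sequentially. a (Suc k) / a k * R r2 (Suc k) < (2 * s) ^ n + e"
    using r by (intro order_tendstoD(2)) auto
  moreover have "(\<lambda>k. a k / a (Suc k) * R r1 k) \<longlonglongrightarrow> 1 * (2 * r1) ^ n"
    using lim[OF r1(1) r(1)] by (intro tendsto_mult ratio') (simp add: R_def a_def)
  then have "\<forall>\<^sub>F k in sequentially. (2 * s) ^ n - e < a k / a (Suc k) * R r1 k"
    using r by (intro order_tendstoD(1)) auto
  moreover have "(\<lambda>k. (a (Suc k) / a k) powr \<rho>) \<longlonglongrightarrow> 1 powr \<rho>"
    by (intro tendsto_powr ratio tendsto_const) auto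
  then have "\<forall>\<^sub>F k in sequentially. (a (Suc k) / a k) powr \<rho> < min (r2 / s) (s / r1)"
    using r r1 r2 s by (intro order_tendstoD(2)) auto
  ultimately have "\<forall>\<^sub>F k in sequentially. a (Suc k) / a k * R r2 (Suc k) < (2 * s) ^ n + e \<and>
    (2 * s) ^ n - e < a k / a (Suc k) * R r1 k \<and> (a (Suc k) / a k) powr \<rho> < min (r2 / s) (s / r1)"
    by eventually_elim auto
  then obtain K where K: "\<And>k. K \<le> k \<Longrightarrow> a (Suc k) / a k * R r2 (Suc k) < (2 * s) ^ n + e \<and>
    (2 * s) ^ n - e < a k / a (Suc k) * R r1 k \<and> (a (Suc k) / a k) powr \<rho> < min (r2 / s) (s / r1)"
    by (auto simp: eventually_sequentially)
  show "\<exists>N0. \<forall>N\<ge>N0. norm (2 * real (f N (s / real N powr \<rho>)) / real N - (2 * s) ^ n) < e"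
  proof (intro exI allI impI)
    fix N assume N: "Suc K ^ q \<le> N"
    \<comment> \<open>Minimality gives Suc k ^ q \<le> N when k > K; for k = K this is the
      assumption on N.\<close>
    define k where "k = (LEAST k. K \<le> k \<and> N < Suc (Suc k) ^ q)"
    have "K \<le> max K N \<and> N < Suc (Suc (max K N)) ^ q"
      using q self_le_power[of "Suc (Suc (max K N))" q] by auto
    then have k: "K \<le> k \<and> N < Suc (Suc k) ^ q"
      unfolding k_def by (rule LeastI)
    have kN: "Suc k ^ q \<le> N"
    proof (cases "k = K")
      case False
      then have "k - 1 < k" "K \<le> k - 1" "Suc (k - 1) = k"
        using k by auto
      then show ?thesis
        using not_less_Least[of "k - 1" "\<lambda>k. K \<le> k \<and> N < Suc (Suc k) ^ q"] k_def by auto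
    qed (use N in simp)
    have aN: "a k \<le> real N" "real N \<le> a (Suc k)"
      using k kN by (simp_all add: a_def flip: of_nat_power)
    have Npos: "0 < real N"
      using aN apos[of k] by linarith
    have quotient_le: "x / y \<le> z / w" if "x * w \<le> z * y" "0 < y" "0 < w" for x y z w :: real
      using that by (simp add: field_simps)
    have pos: "0 < a k powr \<rho>" "0 < real N powr \<rho>" "0 < a (Suc k) powr \<rho>"
      using apos[of k] apos[of "Suc k"] Npos by simp_all
    have pw: "0 < a k powr \<rho>" "a k powr \<rho> \<le> real N powr \<rho>" "real N powr \<rho> \<le> a (Suc k) powr \<rho>"
      using aN apos[of k] \<rho> by (auto intro: powr_mono2)
    have quot: "(a (Suc k) / a k) powr \<rho> = a (Suc k) powr \<rho> / a k powr \<rho>"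
      by (rule powr_divide)
    have up: "s / real N powr \<rho> \<le> r2 / a (Suc k) powr \<rho>"
    proof -
      have "s * a (Suc k) powr \<rho> \<le> r2 * a k powr \<rho>"
        using K[of k] k s pw unfolding quot by (simp add: field_simps)
      also have "\<dots> \<le> r2 * real N powr \<rho>"
        using pw r by (intro mult_left_mono) auto
      finally show ?thesis
        using pos by (intro quotient_le)
    qed
    have low: "r1 / a k powr \<rho> \<le> s / real N powr \<rho>"
    proof -
      have "r1 * real N powr \<rho> \<le> r1 * a (Suc k) powr \<rho>"
        using pw r by (intro mult_left_mono) auto
      also have "\<dots> \<le> s * a k powr \<rho>"
        using K[of k] k r pw unfolding quot by (simp add: field_simps)
      finally show ?thesis
        using pos by (intro quotient_le)
    qed
    have "2 * real (f N (s / real N powr \<rho>)) / real N \<le> 2 * real (f (Suc (Suc k) ^ q) (r2 / a (Suc k) powr \<rho>)) / a k"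
      using mono[OF less_imp_le[OF conjunct2[OF k]] up] aN apos[of k]
      by (intro frac_le) auto
    also have "\<dots> = a (Suc k) / a k * R r2 (Suc k)"
      using apos[of "Suc k"] by (simp add: R_def)
    finally have U: "2 * real (f N (s / real N powr \<rho>)) / real N < (2 * s) ^ n + e"
      using K[of k] k by linarith
    have "a k / a (Suc k) * R r1 k = 2 * real (f (Suc k ^ q) (r1 / a k powr \<rho>)) / a (Suc k)"
      using apos[of k] by (simp add: R_def)
    also have "\<dots> \<le> 2 * real (f N (s / real N powr \<rho>)) / real N"
      using mono[OF kN low] aN Npos by (intro frac_le) auto
    finally have "(2 * s) ^ n - e < 2 * real (f N (s / real N powr \<rho>)) / real N"
      using K[of k] k by linarith
    with U show "norm (2 * real (f N (s / real N powr \<rho>)) / real N - (2 * s) ^ n) < e"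
      by (simp add: abs_less_iff)
  qed
qed

text \<open>F counts the hits among large pairs and is controlled by the variance. G counts the at
  most N^(2 - 2 \<kappa>) others, each hit with probability O(1 / N), so G / N has mean O(N^(-2
  \<kappa>)). The comparison value t / N tends to half the limit since each unordered pair is
  counted once.\<close>

lemma AE_close_count_along_powers:
  fixes \<theta> c :: "real ^ 'd" and s \<kappa> :: real and q :: nat
  assumes card: "2 \<le> CARD('d)" and s: "0 < s" and \<kappa>: "0 < \<kappa>" "\<kappa> \<le> 1 / 4"
    and \<theta>: "\<And>i. 2 \<le> \<theta> $ i" "\<And>i. 4 * \<kappa> * \<theta> $ i \<le> \<theta> $ i - 2"
    and q: "1 \<le> q" "2 \<le> real q * (\<kappa> / (2 * (real CARD('d) + 1)))"
  shows "AE \<alpha> in cube_space c. (\<lambda>k. 2 * real (close_count \<theta> \<alpha> (Suc k ^ q)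
    (s / real (Suc k ^ q) powr (1 / real CARD('d)))) / real (Suc k ^ q)) \<longlonglongrightarrow> (2 * s) ^ CARD('d)"
proof -
  interpret prob_space "cube_space c"
    by (rule prob_space_cube_space)
  define \<tau> where "\<tau> = \<kappa> / (2 * (real CARD('d) + 1))"
  define L where "L N = real N powr (1 - \<kappa>)" for N :: nat
  define B where "B N = large_pairs (L N) N" for N
  define S where "S N = ordered_pairs N - B N" for N
  define \<delta> where "\<delta> N = s / real N powr (1 / real CARD('d))" for N :: nat
  define F where "F N \<alpha> = (\<Sum>w\<in>B N. indicator (hit_set c \<theta> (\<delta> N) w) \<alpha> :: real)" for N \<alpha>
  define G where "G N \<alpha> = (\<Sum>w\<in>S N. indicator (hit_set c \<theta> (\<delta> N) w) \<alpha> :: real)" for N \<alpha>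
  define t where "t N = real (card (B N)) * (2 * \<delta> N) ^ CARD('d)" for N
  have BS: "B N \<subseteq> ordered_pairs N" "finite (B N)" "finite (S N)" for N
  proof -
    show "B N \<subseteq> ordered_pairs N"
      by (auto simp: B_def large_pairs_def ordered_pairs_def)
  qed (simp_all add: B_def S_def)
  have \<tau>: "0 < \<tau>" "\<tau> \<le> \<kappa>"
  proof -
    show "0 < \<tau>"
      using \<kappa> by (simp add: \<tau>_def)
    have "\<kappa> / (2 * (real CARD('d) + 1)) \<le> \<kappa> / 1"
      using \<kappa> by (intro divide_left_mono) auto
    then show "\<tau> \<le> \<kappa>"
      by (simp add: \<tau>_def)
  qed
  have \<delta>_pow: "(a * \<delta> N) ^ CARD('d) = (a * s) ^ CARD('d) / real N" if "0 < N" for a N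
  proof -
    have "(real N powr (1 / real CARD('d))) ^ CARD('d) = real N"
      using that by (simp add: powr_power)
    then show ?thesis
      by (simp add: \<delta>_def power_divide)
  qed
  have cardS: "real (card (S N)) \<le> real N powr (2 - 2 * \<kappa>)" for N
  proof -
    have "S N \<subseteq> {1..nat \<lfloor>L N\<rfloor>} \<times> {1..nat \<lfloor>L N\<rfloor>}"
    proof
      fix w assume "w \<in> S N"
      then have w: "1 \<le> snd w" "snd w < fst w" "real (fst w) \<le> L N"
        by (auto simp: S_def B_def ordered_pairs_def large_pairs_def)
      then have "fst w \<le> nat \<lfloor>L N\<rfloor>"
        by (intro le_nat_floor)
      then show "w \<in> {1..nat \<lfloor>L N\<rfloor>} \<times> {1..nat \<lfloor>L N\<rfloor>}"
        using w by (auto simp: mem_Times_iff)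
    qed
    then have "card (S N) \<le> nat \<lfloor>L N\<rfloor> * nat \<lfloor>L N\<rfloor>"
      using card_mono[of "{1..nat \<lfloor>L N\<rfloor>} \<times> {1..nat \<lfloor>L N\<rfloor>}" "S N"] by (simp add: card_cartesian_product)
    then have "real (card (S N)) \<le> real (nat \<lfloor>L N\<rfloor>) * real (nat \<lfloor>L N\<rfloor>)"
      by (metis of_nat_le_iff of_nat_mult)
    also have "\<dots> \<le> L N * L N"
      by (intro mult_mono) (auto simp: L_def of_nat_floor)
    also have "\<dots> = real N powr (2 - 2 * \<kappa>)"
      by (simp add: L_def flip: powr_add)
    finally show ?thesis .
  qed
  have AE1: "AE \<alpha> in cube_space c. (\<lambda>k. (F (Suc k ^ q) \<alpha> - t (Suc k ^ q))\<^sup>2 / (real (Suc k ^ q))\<^sup>2) \<longlonglongrightarrow> 0"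
  proof -
    obtain C where C: "\<forall>\<^sub>F N in sequentially.
        (\<integral>\<alpha>. (F N \<alpha> - t N)\<^sup>2 \<partial>cube_space c) \<le> C * real N powr (2 - \<tau>)"
      using eventually_integral_deviation_le[OF card s \<kappa> \<theta>, of c]
      unfolding F_def t_def B_def L_def \<delta>_def \<tau>_def by blast
    show ?thesis
    proof (rule AE_tendsto_zero_along_powers[where g = "\<lambda>N \<alpha>. (F N \<alpha> - t N)\<^sup>2 / (real N)\<^sup>2" and C = C and \<eta> = \<tau>])
      show "integrable (cube_space c) (\<lambda>\<alpha>. (F N \<alpha> - t N)\<^sup>2 / (real N)\<^sup>2)" for N
        unfolding F_def using BS by (intro integrable_divide integral_square_sum_indicator(1)) auto
      show "\<forall>\<^sub>F N in sequentially. (\<integral>\<alpha>. (F N \<alpha> - t N)\<^sup>2 / (real N)\<^sup>2 \<partial>cube_space c) \<le> C * real N powr (- \<tau>)"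
        using C eventually_gt_at_top[of 0]
      proof eventually_elim
        case (elim N)
        then have "(\<integral>\<alpha>. (F N \<alpha> - t N)\<^sup>2 \<partial>cube_space c) / (real N)\<^sup>2 \<le> C * real N powr (2 - \<tau>) / (real N)\<^sup>2"
          by (intro divide_right_mono) auto
        also have "\<dots> = C * real N powr (- \<tau>)"
          using elim by (simp add: powr_diff powr_minus powr_numeral divide_inverse)
        finally show ?case
          by simp
      qed
    qed (use q in \<open>auto simp: \<tau>_def\<close>)
  qed
  have AE2: "AE \<alpha> in cube_space c. (\<lambda>k. G (Suc k ^ q) \<alpha> / real (Suc k ^ q)) \<longlonglongrightarrow> 0"
  proof (rule AE_tendsto_zero_along_powers[where g = "\<lambda>N \<alpha>. G N \<alpha> / real N" and C = "(6 * s) ^ CARD('d)" and \<eta> = \<tau>])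
    have int: "integrable (cube_space c) (indicator (hit_set c \<theta> (\<delta> N) w) :: _ \<Rightarrow> real)" for N w
      by (simp add: integrable_real_indicator emeasure_eq_measure)
    then show "integrable (cube_space c) (\<lambda>\<alpha>. G N \<alpha> / real N)" for N
      unfolding G_def by (intro integrable_divide Bochner_Integration.integrable_sum)
    have "\<forall>\<^sub>F N in sequentially. 2 * s * real N powr 0 < real N powr (1 / real CARD('d))"
      by (rule eventually_powr_less) simp
    then show "\<forall>\<^sub>F N in sequentially. (\<integral>\<alpha>. G N \<alpha> / real N \<partial>cube_space c) \<le> (6 * s) ^ CARD('d) * real N powr (- \<tau>)"
      using eventually_gt_at_top[of 0]
    proof eventually_elim
      case (elim N)
      have d: "0 \<le> \<delta> N" "2 * \<delta> N \<le> 1"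
        using s elim by (auto simp: \<delta>_def divide_le_eq)
      have "(\<integral>\<alpha>. G N \<alpha> \<partial>cube_space c) = (\<Sum>w\<in>S N. prob (hit_set c \<theta> (\<delta> N) w))"
        unfolding G_def using int by (subst Bochner_Integration.integral_sum) auto
      also have "\<dots> \<le> (\<Sum>w\<in>S N. (6 * \<delta> N) ^ CARD('d))"
      proof (intro sum_mono measure_hit_set_le d)
        fix w i assume "w \<in> S N"
        then have w: "1 \<le> snd w" "snd w < fst w"
          by (auto simp: S_def ordered_pairs_def)
        then have "1 \<le> real (fst w) powr (\<theta> $ i - 1)"
          using \<theta>(1)[of i] by (intro ge_one_powr_ge_zero) auto
        also have "\<dots> \<le> powr_gap (\<theta> $ i) w"
          unfolding powr_gap_def using w \<theta>(1)[of i] by (intro powr_diff_ge) auto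
        finally show "1 \<le> powr_gap (\<theta> $ i) w" .
      qed
      also have "\<dots> = real (card (S N)) * ((6 * s) ^ CARD('d) / real N)"
        using elim by (simp only: sum_constant \<delta>_pow)
      also have "\<dots> \<le> real N powr (2 - 2 * \<kappa>) * ((6 * s) ^ CARD('d) / real N)"
        using s by (intro mult_right_mono cardS) auto
      finally have "(\<integral>\<alpha>. G N \<alpha> \<partial>cube_space c) / real N
        \<le> real N powr (2 - 2 * \<kappa>) * ((6 * s) ^ CARD('d) / real N) / real N"
        by (intro divide_right_mono) auto
      also have "\<dots> = (6 * s) ^ CARD('d) * real N powr (- 2 * \<kappa>)"
        using elim powr_add[of "real N" 2 "- 2 * \<kappa>"] by (simp add: powr_numeral power2_eq_square)
      also have "\<dots> \<le> (6 * s) ^ CARD('d) * real N powr (- \<tau>)"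
        using s elim \<tau> \<kappa> by (intro mult_left_mono powr_mono) auto
      finally show ?case
        by simp
    qed
    show "0 \<le> G N x / real N" for N x
      unfolding G_def by (intro divide_nonneg_nonneg sum_nonneg) auto
  qed (use q in \<open>auto simp: \<tau>_def\<close>)
  have t_lim: "(\<lambda>N. t N / real N) \<longlonglongrightarrow> (2 * s) ^ CARD('d) / 2"
  proof -
    define u where "u N = real (card (S N)) / (real N)\<^sup>2" for N
    have lim: "(\<lambda>N. real N powr (- 2 * \<kappa>)) \<longlonglongrightarrow> 0"
      using \<kappa> by real_asymp
    have upper: "\<forall>\<^sub>F N in sequentially. u N \<le> real N powr (- 2 * \<kappa>)"
      using eventually_gt_at_top[of 0]
    proof eventually_elim
      case (elim N)
      have "u N \<le> real N powr (2 - 2 * \<kappa>) / (real N)\<^sup>2"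
        unfolding u_def by (intro divide_right_mono cardS) auto
      also have "\<dots> = real N powr (- 2 * \<kappa>)"
        using elim by (simp add: powr_diff powr_minus powr_numeral divide_inverse)
      finally show ?case .
    qed
    have "\<forall>\<^sub>F N in sequentially. 0 \<le> u N"
      by (simp add: u_def)
    then have "u \<longlonglongrightarrow> 0"
      by (rule tendsto_sandwich[OF _ upper tendsto_const lim])
    moreover have "(\<lambda>N. (1 - 1 / real N) / 2) \<longlonglongrightarrow> 1 / 2"
      by real_asymp
    ultimately have "(\<lambda>N. ((1 - 1 / real N) / 2 - u N) * (2 * s) ^ CARD('d)) \<longlonglongrightarrow> (1 / 2 - 0) * (2 * s) ^ CARD('d)"
      by (intro tendsto_mult tendsto_diff tendsto_const)
    moreover have "\<forall>\<^sub>F N in sequentially. ((1 - 1 / real N) / 2 - u N) * (2 * s) ^ CARD('d) = t N / real N"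
      using eventually_gt_at_top[of 0]
    proof eventually_elim
      case (elim N)
      have "card (S N) + card (B N) = card (ordered_pairs N)"
        unfolding S_def using BS[of N] by (simp add: card_Diff_subset card_mono)
      then have "real (card (B N)) = real N * (real N - 1) / 2 - real (card (S N))"
        unfolding card_ordered_pairs[symmetric] by linarith
      then have "real (card (B N)) / (real N)\<^sup>2 = (real N * (real N - 1) / 2 - real (card (S N))) / (real N)\<^sup>2"
        by (simp only:)
      also have "\<dots> = (1 - 1 / real N) / 2 - u N"
        using elim by (simp add: u_def diff_divide_distrib power2_eq_square right_diff_distrib)
      finally have "real (card (B N)) / (real N)\<^sup>2 = (1 - 1 / real N) / 2 - u N" .
      moreover have "t N / real N = real (card (B N)) / (real N)\<^sup>2 * (2 * s) ^ CARD('d)"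
        unfolding t_def \<delta>_pow[OF elim] by (simp add: power2_eq_square)
      ultimately show ?case
        by simp
    qed
    ultimately show ?thesis
      by (rule Lim_transform_eventually[THEN tendsto_eq_rhs]) simp
  qed
  have powers: "filterlim (\<lambda>k. Suc k ^ q) at_top sequentially"
  proof (rule filterlim_at_top_mono[OF filterlim_Suc])
    show "\<forall>\<^sub>F k in sequentially. Suc k \<le> Suc k ^ q"
      using q(1) by (intro always_eventually allI) (simp add: self_le_power)
  qed
  have count: "real (close_count \<theta> \<alpha> N (\<delta> N)) = F N \<alpha> + G N \<alpha>" if "\<alpha> \<in> unit_cube c" for \<alpha> N
  proof -
    have "indicator (hit_set c \<theta> (\<delta> N) w) \<alpha> = (of_bool (\<forall>i. nint (powr_gap (\<theta> $ i) w * \<alpha> $ i) \<le> \<delta> N) :: real)" for w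
      using that by (auto simp: indicator_def hit_set_def near_int_set_def unit_cube_def)
    then have "F N \<alpha> + G N \<alpha> = (\<Sum>w\<in>B N \<union> S N. of_bool (\<forall>i. nint (powr_gap (\<theta> $ i) w * \<alpha> $ i) \<le> \<delta> N))"
      unfolding F_def G_def using BS by (subst sum.union_disjoint) (auto simp: S_def)
    also have "B N \<union> S N = ordered_pairs N"
      using BS(1) by (auto simp: S_def)
    finally show ?thesis
      by (simp add: close_count_def of_bool_def sum.If_cases Int_def)
  qed
  from AE1 AE2 show ?thesis
    using AE_space
  proof eventually_elim
    case (elim \<alpha>)
    then have \<alpha>: "\<alpha> \<in> unit_cube c"
      by (simp add: space_cube_space)
    have "(\<lambda>k. sqrt ((F (Suc k ^ q) \<alpha> - t (Suc k ^ q))\<^sup>2 / (real (Suc k ^ q))\<^sup>2)) \<longlonglongrightarrow> sqrt 0"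
      by (intro tendsto_real_sqrt elim)
    then have "(\<lambda>k. \<bar>(F (Suc k ^ q) \<alpha> - t (Suc k ^ q)) / real (Suc k ^ q)\<bar>) \<longlonglongrightarrow> 0"
      by (simp add: real_sqrt_divide)
    then have "(\<lambda>k. (F (Suc k ^ q) \<alpha> - t (Suc k ^ q)) / real (Suc k ^ q)) \<longlonglongrightarrow> 0"
      by (rule tendsto_rabs_zero_cancel)
    moreover have "(\<lambda>k. t (Suc k ^ q) / real (Suc k ^ q)) \<longlonglongrightarrow> (2 * s) ^ CARD('d) / 2"
      by (rule filterlim_compose[OF t_lim powers])
    ultimately have lim: "(\<lambda>k. 2 * ((F (Suc k ^ q) \<alpha> - t (Suc k ^ q)) / real (Suc k ^ q)
        + t (Suc k ^ q) / real (Suc k ^ q) + G (Suc k ^ q) \<alpha> / real (Suc k ^ q)))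
      \<longlonglongrightarrow> 2 * (0 + (2 * s) ^ CARD('d) / 2 + 0)"
      using elim(2) by (intro tendsto_mult tendsto_add tendsto_const)
    have "2 * ((F N \<alpha> - t N) / real N + t N / real N + G N \<alpha> / real N)
      = 2 * real (close_count \<theta> \<alpha> N (\<delta> N)) / real N" for N
      unfolding count[OF \<alpha>] by (simp add: diff_divide_distrib add_divide_distrib)
    then show ?case
      using lim unfolding \<delta>_def by (simp only:) (rule tendsto_eq_rhs, assumption, simp)
  qed
qed

theorem corollary1p3:
  fixes \<theta> :: "real ^ 'd"
  assumes "CARD('d) \<ge> 2"
    and "\<And>i. \<theta> $ i > 2"
  shows "has_MPPC (\<lambda>n. \<chi> i. real n powr (\<theta> $ i))"
proof -
  let ?n = "real CARD('d)"
  \<comment> \<open>The largest value with \<kappa> \<le> 1 / 4 and 4 \<kappa> \<theta> \<le>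
    \<theta> - 2 in every coordinate, positive because all exponents exceed 2.\<close>
  define \<kappa> where "\<kappa> = Min (insert (1 / 4) (range (\<lambda>i. (\<theta> $ i - 2) / (4 * \<theta> $ i))))"
  have \<theta>: "2 \<le> \<theta> $ i" "0 < \<theta> $ i" for i
    using assms(2)[of i] by auto
  have \<kappa>: "0 < \<kappa>" "\<kappa> \<le> 1 / 4"
    unfolding \<kappa>_def using assms(2) \<theta>(2) by (auto simp: Min_gr_iff)
  have \<kappa>\<theta>: "4 * \<kappa> * \<theta> $ i \<le> \<theta> $ i - 2" for i
  proof -
    have "\<kappa> \<le> (\<theta> $ i - 2) / (4 * \<theta> $ i)"
      unfolding \<kappa>_def by (intro Min_le) auto
    then show ?thesis
      using \<theta>(2)[of i] by (simp add: pos_le_divide_eq mult_ac)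
  qed
  define \<tau> where "\<tau> = \<kappa> / (2 * (?n + 1))"
  \<comment> \<open>Chosen so that q \<tau> \<ge> 2, which makes N^(-\<tau>) summable along N = (k +
    1)^q.\<close>
  define q where "q = nat \<lceil>2 / \<tau>\<rceil>"
  have \<tau>: "0 < \<tau>"
    using \<kappa> by (simp add: \<tau>_def)
  then have "0 < 2 / \<tau>"
    by simp
  then have q: "1 \<le> q" "2 / \<tau> \<le> real q"
    unfolding q_def by linarith+
  then have q2: "2 \<le> real q * (\<kappa> / (2 * (?n + 1)))"
    unfolding \<tau>_def[symmetric] using \<tau> by (simp add: divide_le_eq)
  define PPC where "PPC \<alpha> = has_PPC (\<lambda>n. \<chi> i. frac ((\<chi> i. real n powr (\<theta> $ i)) $ i * \<alpha> $ i))" for \<alpha>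
  have cube: "AE \<alpha> in lborel. \<alpha> \<in> unit_cube c \<longrightarrow> PPC \<alpha>" for c
  proof -
    have "AE \<alpha> in cube_space c. \<forall>r\<in>\<rat> \<inter> {0<..}. (\<lambda>k. 2 * real (close_count \<theta> \<alpha> (Suc k ^ q)
        (r / real (Suc k ^ q) powr (1 / ?n))) / real (Suc k ^ q)) \<longlonglongrightarrow> (2 * r) ^ CARD('d)"
    proof (subst AE_ball_countable, intro countable_Int1 countable_rat, intro ballI)
      fix r :: real assume "r \<in> \<rat> \<inter> {0<..}"
      then show "AE \<alpha> in cube_space c. (\<lambda>k. 2 * real (close_count \<theta> \<alpha> (Suc k ^ q)
        (r / real (Suc k ^ q) powr (1 / ?n))) / real (Suc k ^ q)) \<longlonglongrightarrow> (2 * r) ^ CARD('d)"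
        by (intro AE_close_count_along_powers[OF assms(1) _ \<kappa> \<theta>(1) \<kappa>\<theta> q(1) q2]) auto
    qed
    then have "AE \<alpha> in cube_space c. PPC \<alpha>"
    proof eventually_elim
      case (elim \<alpha>)
      show ?case
        unfolding PPC_def has_PPC_def pair_correlation_eq_close_count
      proof (intro allI impI)
        fix s :: real assume "0 < s"
        then show "(\<lambda>N. 2 * real (close_count \<theta> \<alpha> N (s / real N powr (1 / ?n))) / real N) \<longlonglongrightarrow> (2 * s) ^ CARD('d)"
          using elim q(1)
          by (intro tendsto_of_tendsto_along_powers[where q = q and \<rho> = "1 / ?n"] close_count_mono) auto
      qed
    qed
    then show ?thesis
      unfolding cube_space_def by (subst (asm) AE_restrict_space_iff) auto
  qed
  \<comment> \<open>The cubes with integer corners are countably many and cover the whole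
    space.\<close>
  have "AE \<alpha> in lborel. \<forall>z :: 'd \<Rightarrow> int. \<alpha> \<in> unit_cube (\<chi> i. of_int (z i)) \<longrightarrow> PPC \<alpha>"
    using cube by (subst AE_all_countable) blast
  then have "AE \<alpha> in lborel. PPC \<alpha>"
  proof eventually_elim
    case (elim \<alpha>)
    have "\<alpha> \<in> unit_cube (\<chi> i. of_int \<lfloor>\<alpha> $ i\<rfloor>)"
      by (auto simp: unit_cube_def intro: less_imp_le)
    then show ?case
      using elim[rule_format, of "\<lambda>i. \<lfloor>\<alpha> $ i\<rfloor>"] by simp
  qed
  then have "AE \<alpha> in lebesgue. PPC \<alpha>"
    by (rule AE_completion)
  then show ?thesis
    by (simp add: has_MPPC_def PPC_def)
qed

end
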